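(* Assume the setting described in the context, assume $\langle\mu_n:n<\omega\rangle$ carries a scale, and assume the ideal $\mathrm{id}_p(\bar C,\bar I)$ is not weakly $\mu$-saturated. Then there is a coloring $d:[\lambda]^3\to\lambda$ such that whenever $\langle t_\alpha:\alpha<\lambda\rangle$ is a pairwise disjoint collection of finite subsets of $\lambda$ and $\varsigma<\lambda$, there are $\alpha<\beta<\gamma$ such that $d(\epsilon,\zeta,\xi)=\varsigma$ for all $\epsilon\in t_\alpha$, $\zeta\in t_\beta$, $\xi\in t_\gamma$.
   Context: Setting: $\mu$ is a singular cardinal with $\mathrm{cf}(\mu)=\aleph_0$, $\lambda=\mu^+$, $\sigma$ is regular with $\aleph_0<\sigma<\mu$, $S$ is a stationary subset of $\{\delta<\lambda:\mathrm{cf}(\delta)=\sigma\}$, and $\langle\mu_n:n<\omega\rangle$ is a strictly increasing sequence of regular cardinals cofinal in $\mu$ with $\sigma<\mu_0$. For $\delta\in S$, $c^0_\delta$ is the increasing enumeration of a club subset of $\delta$ of order type $\sigma$, and for every club $E\subseteq\lambda$ the set of $\delta\in S$ with $\mathrm{ran}(c^0_\delta)\subseteq E$ is stationary. $I(\delta,\epsilon,m)=(c^0_\delta(\omega\cdot\epsilon+m),c^0_\delta(\omega\cdot\epsilon+m+1)]$. $\bar C=\langle C_\delta:\delta\in S\rangle$ satisfies: $C_\delta$ club in $\delta$; $\mathrm{ran}(c^0_\delta)\subseteq C_\delta$; $|C_\delta\cap I(\delta,\epsilon,m)|\leq\mu_m^+$; every $\alpha\in\mathrm{nacc}(C_\delta)\cap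 I(\delta,\epsilon,m)$ has $\mathrm{cf}(\alpha)>\mu_m^+$; for every club $E\subseteq\lambda$ there are stationarily many $\delta\in S$ with $E\cap\mathrm{nacc}(C_\delta)\cap I(\delta,\epsilon,m)\neq\emptyset$ for all $\epsilon<\sigma$, $m<\omega$ ($\mathrm{acc}(C)=\{\alpha<\delta:\alpha=\sup(\alpha\cap C)\}$, $\mathrm{nacc}(C)=C\setminus\mathrm{acc}(C)$). $I_\delta$ is the ideal on $C_\delta$ generated by the sets $\{\gamma\in C_\delta:\gamma\in\mathrm{acc}(C_\delta)\text{ or }\mathrm{cf}(\gamma)<\alpha\text{ or }\gamma<\beta\}$ ($\alpha<\mu$, $\beta<\delta$); $\mathrm{id}_p(\bar C,\bar I)$ is the ideal of $A\subseteq\lambda$ such that for some club $E$, $A\cap E\cap C_\delta\in I_\delta$ for all $\delta\in S\cap E$. An ideal on $\lambda$ is weakly $\theta$-saturated if there is no partition of $\lambda$ into $\theta$ disjoint sets not in the ideal. "Carries a scale": there are $f_\alpha\in\prod_n\mu_n$ ($\alpha<\lambda$), increasing modulo finite, and cofinal in $\prod_n\mu_n$ modulo finite. *)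

theory Defs
  imports Main "HOL-Library.Equipollence" "HOL-Library.Countable_Set"
begin

text \<open>Ordinals below lambda are the elements of a well-ordered type 'a whose
  order type is lambda.  An ordinal x is identified with seg x.\<close>

definition seg :: "'a::wellorder \<Rightarrow> 'a set" where
  "seg x = {y. y < x}"

definition cofinal_in :: "'a::wellorder set \<Rightarrow> 'a \<Rightarrow> bool" where
  "cofinal_in A x \<longleftrightarrow> (\<forall>y<x. \<exists>a\<in>A. y \<le> a)"

definition cof :: "'a::wellorder \<Rightarrow> 'a" where
  "cof x = (LEAST k. \<exists>A \<subseteq> seg x. cofinal_in A x \<and> A \<approx> seg k)"

definition is_cardinal :: "'a::wellorder \<Rightarrow> bool" where
  "is_cardinal x \<longleftrightarrow> (\<forall>y<x. \<not> (seg y \<approx> seg x))"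

definition regular :: "'a::wellorder \<Rightarrow> bool" where
  "regular x \<longleftrightarrow> is_cardinal x \<and> infinite (seg x) \<and> cof x = x"

definition csuc :: "'a::wellorder \<Rightarrow> 'a" where
  "csuc k = (LEAST x. seg k \<prec> seg x)"

definition succ :: "'a::wellorder \<Rightarrow> 'a" where
  "succ x = (LEAST y. x < y)"

definition limit_or_zero :: "'a::wellorder \<Rightarrow> bool" where
  "limit_or_zero x \<longleftrightarrow> (\<forall>y<x. \<exists>z. y < z \<and> z < x)"

definition ord_iso :: "'a::wellorder set \<Rightarrow> 'a set \<Rightarrow> bool" where
  "ord_iso A B \<longleftrightarrow> (\<exists>f. bij_betw f A B \<and> strict_mono_on A f)"

text \<open>omega * e: the e-th ordinal that is zero or a limit\<close>
definition omega_mul :: "'a::wellorder \<Rightarrow> 'a" where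
  "omega_mul e = (THE x. limit_or_zero x \<and> ord_iso (seg e) ({y. limit_or_zero y} \<inter> seg x))"

definition oidx :: "'a::wellorder \<Rightarrow> nat \<Rightarrow> 'a" where
  "oidx e m = (succ ^^ m) (omega_mul e)"

definition club_in :: "'a::wellorder set \<Rightarrow> 'a \<Rightarrow> bool" where
  "club_in C \<delta> \<longleftrightarrow> C \<subseteq> seg \<delta> \<and> (\<forall>\<beta><\<delta>. \<exists>c\<in>C. \<beta> \<le> c) \<and>
     (\<forall>\<alpha><\<delta>. (\<exists>\<beta>. \<beta> < \<alpha>) \<and> (\<forall>\<beta><\<alpha>. \<exists>c\<in>C. \<beta> < c \<and> c < \<alpha>) \<longrightarrow> \<alpha> \<in> C)"

definition club :: "'a::wellorder set \<Rightarrow> bool" where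
  "club E \<longleftrightarrow> (\<forall>\<beta>. \<exists>e\<in>E. \<beta> < e) \<and>
     (\<forall>\<alpha>. (\<exists>\<beta>. \<beta> < \<alpha>) \<and> (\<forall>\<beta><\<alpha>. \<exists>e\<in>E. \<beta> < e \<and> e < \<alpha>) \<longrightarrow> \<alpha> \<in> E)"

definition stationary :: "'a::wellorder set \<Rightarrow> bool" where
  "stationary S \<longleftrightarrow> (\<forall>E. club E \<longrightarrow> S \<inter> E \<noteq> {})"

definition acc :: "'a::wellorder set \<Rightarrow> 'a \<Rightarrow> 'a set" where
  "acc C \<delta> = {\<alpha>. \<alpha> < \<delta> \<and> (\<forall>\<beta><\<alpha>. \<exists>c\<in>C. \<beta> < c \<and> c < \<alpha>)}"

definition nacc :: "'a::wellorder set \<Rightarrow> 'a \<Rightarrow> 'a set" where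
  "nacc C \<delta> = C - acc C \<delta>"

definition Iv :: "('a::wellorder \<Rightarrow> 'a \<Rightarrow> 'a) \<Rightarrow> 'a \<Rightarrow> 'a \<Rightarrow> nat \<Rightarrow> 'a set" where
  "Iv c0 \<delta> e m = {x. c0 \<delta> (oidx e m) < x \<and> x \<le> c0 \<delta> (succ (oidx e m))}"

definition gen_ideal :: "'b set \<Rightarrow> 'b set set \<Rightarrow> 'b set set" where
  "gen_ideal X G = {A. A \<subseteq> X \<and> (\<exists>F. finite F \<and> F \<subseteq> G \<and> A \<subseteq> \<Union>F)}"

definition Idelta :: "'a::wellorder \<Rightarrow> ('a \<Rightarrow> 'a set) \<Rightarrow> 'a \<Rightarrow> 'a set set" where
  "Idelta \<mu> C \<delta> = gen_ideal (C \<delta>)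
     {{\<gamma> \<in> C \<delta>. \<gamma> \<in> acc (C \<delta>) \<delta> \<or> cof \<gamma> < a \<or> \<gamma> < b} | a b. a < \<mu> \<and> b < \<delta>}"

definition idp :: "'a::wellorder \<Rightarrow> 'a set \<Rightarrow> ('a \<Rightarrow> 'a set) \<Rightarrow> 'a set set" where
  "idp \<mu> S C = {A. \<exists>E. club E \<and> (\<forall>\<delta>\<in>S \<inter> E. A \<inter> E \<inter> C \<delta> \<in> Idelta \<mu> C \<delta>)}"

definition weakly_saturated :: "'a::wellorder set set \<Rightarrow> 'a \<Rightarrow> bool" where
  "weakly_saturated J \<theta> \<longleftrightarrow> \<not> (\<exists>P :: 'a \<Rightarrow> 'a set.
     (\<forall>i<\<theta>. P i \<notin> J) \<and> (\<forall>i<\<theta>. \<forall>j<\<theta>. i \<noteq> j \<longrightarrow> P i \<inter> P j = {}) \<and>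
     (\<Union>i\<in>seg \<theta>. P i) = UNIV)"

definition carries_scale :: "(nat \<Rightarrow> 'a::wellorder) \<Rightarrow> bool" where
  "carries_scale \<mu>s \<longleftrightarrow> (\<exists>f :: 'a \<Rightarrow> nat \<Rightarrow> 'a.
     (\<forall>\<alpha> n. f \<alpha> n < \<mu>s n) \<and>
     (\<forall>\<alpha> \<beta>. \<alpha> < \<beta> \<longrightarrow> (\<forall>\<^sub>F n in sequentially. f \<alpha> n < f \<beta> n)) \<and>
     (\<forall>g. (\<forall>n. g n < \<mu>s n) \<longrightarrow> (\<exists>\<alpha>. \<forall>\<^sub>F n in sequentially. g n \<le> f \<alpha> n)))"

end

theory Submission
  imports Defs
begin

text \<open>Let \<open>\<epsilon> < \<zeta> < \<xi>\<close>.  The pair \<open>\<zeta>, \<xi>\<close> determines m, the last coordinate at which the scale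
  function of \<open>\<zeta>\<close> exceeds that of \<open>\<xi>\<close>, and \<open>\<epsilon>\<close> then determines the least point \<open>\<gamma> \<ge> \<epsilon>\<close> of a set
  \<open>hull \<xi> m\<close> of size at most \<open>\<mu>\<^sub>m\<^sup>+\<close> attached to \<open>\<xi>\<close>.  The colour is read off from the piece of a
  partition witnessing non-saturation that contains \<open>\<gamma>\<close>.

  For \<open>\<delta> \<in> S\<close> below \<open>\<xi>\<close> and all large m, the set \<open>hull \<xi> m\<close> contains the part of \<open>C\<^sub>\<delta>\<close> lying in the
  intervals with index at most m, so no iterated walk is needed: choose \<open>\<delta>\<close> in S and in a suitable club such that the given piece is positive on \<open>C\<^sub>\<delta>\<close>, put all \<open>\<xi>\<close> above \<open>\<delta>\<close>,
  and take \<open>\<gamma>\<close> in the piece with cofinality above \<open>\<mu>\<^sub>m\<^sup>+\<close>.  Points \<open>\<epsilon>\<close> just below \<open>\<gamma>\<close> are sent to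
  \<open>\<gamma>\<close>.  Since \<open>\<delta>\<close> has uncountable cofinality, one bound on m works for cofinally many ordinals
  below \<open>\<delta>\<close>, and the scale provides sets between \<open>\<gamma>\<close> and \<open>\<delta>\<close> on which m is as prescribed.\<close>

section \<open>Initial segments and cardinal arithmetic\<close>

lemma seg_iff [simp]: "x \<in> seg y \<longleftrightarrow> x < y"
  by (simp add: seg_def)

lemma seg_mono: "x \<le> y \<Longrightarrow> seg x \<subseteq> seg y"
  by auto

lemma UN_lepoll:
  assumes "infinite K" and "I \<lesssim> K" and "\<And>i. i \<in> I \<Longrightarrow> F i \<lesssim> K"
  shows "(\<Union>i\<in>I. F i) \<lesssim> K"
  using card_of_UNION_ordLeq_infinite [of K I F] assms
  unfolding lepoll_def card_of_ordLeq by simp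

lemma Times_lepoll:
  assumes "infinite K" and "A \<lesssim> K" and "B \<lesssim> K"
  shows "A \<times> B \<lesssim> K"
proof -
  have "A \<times> B = (\<Union>a\<in>A. {a} \<times> B)" by auto
  moreover have "{a} \<times> B \<lesssim> K" for a
    using times_singleton_eqpoll assms(3) by (rule lepoll_trans1)
  then have "(\<Union>a\<in>A. {a} \<times> B) \<lesssim> K"
    by (rule UN_lepoll [OF assms(1,2)])
  ultimately show ?thesis by (simp only:)
qed

lemma countable_lepoll_infinite:
  assumes "countable A" and "infinite K"
  shows "A \<lesssim> K"
proof -
  have "A \<lesssim> (UNIV::nat set)"
    using assms(1) unfolding countable_def lepoll_def by blast
  then show ?thesis
    using assms(2) infinite_le_lepoll lepoll_trans by blast
qed

lemma lists_lepoll_infinite: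
  assumes "infinite A"
  shows "lists A \<lesssim> A"
proof -
  have "{xs \<in> lists A. length xs = n} \<lesssim> A" for n
  proof (induction n)
    case 0
    have "{xs \<in> lists A. length xs = 0} \<subseteq> {[]}" by auto
    then show ?case
      using assms by (meson finite.emptyI finite.insertI finite_lepoll_infinite finite_subset)
  next
    case (Suc n)
    have "{xs \<in> lists A. length xs = Suc n}
        \<subseteq> (\<lambda>(x, xs). x # xs) ` (A \<times> {xs \<in> lists A. length xs = n})"
      by (force simp: length_Suc_conv)
    then show ?case
      by (rule lepoll_trans [OF subset_image_lepoll Times_lepoll [OF assms lepoll_refl Suc.IH]])
  qed
  moreover have "lists A = (\<Union>n. {xs \<in> lists A. length xs = n})" by auto
  ultimately show ?thesis
    using UN_lepoll [OF assms countable_lepoll_infinite [OF _ assms],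
        of UNIV "\<lambda>n. {xs \<in> lists A. length xs = n}"] by simp
qed

section \<open>Order types of sets of ordinals, and cofinality\<close>

text \<open>This is the Mostowski collapse: \<open>c z\<close> is the least ordinal above all
  \<open>c y\<close> with y in A below z. Induction gives \<open>c z \<le> z\<close>, so the order
  type \<open>c x\<close> is at most x, and the inverse of c enumerates A.\<close>

lemma collapse:
  fixes A :: "'a::wellorder set"
  assumes "A \<subseteq> seg x"
  obtains e g where "e \<le> x" and "bij_betw g (seg e) A" and "strict_mono_on (seg e) g"
proof -
  define R where "R = {(y, z). y \<in> A \<and> y < (z::'a)}"
  \<comment> \<open>The recursion descends through A only, but c is defined at every z, so that its
    value at x itself is the order type of A.\<close>
  define c where "c = wfrec R (\<lambda>h z. LEAST w::'a. \<forall>y\<in>A. y < z \<longrightarrow> h y < w)"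
  have "wf R"
    by (rule wf_subset [OF wf]) (auto simp: R_def)
  have c: "c z = (LEAST w. \<forall>y\<in>A. y < z \<longrightarrow> c y < w)" for z
    unfolding c_def
    by (subst wfrec [OF \<open>wf R\<close>], rule arg_cong [where f = Least], rule ext)
      (auto simp: cut_def R_def)
  have le: "c z \<le> z" for z
  proof (induction z rule: less_induct)
    case (less z)
    show ?case
      by (subst c, rule Least_le) (use less in \<open>meson le_less_trans\<close>)
  qed
  have mono: "c y < c z" if "y \<in> A" "y < z" for y z
  proof -
    have "\<forall>y\<in>A. y < z \<longrightarrow> c y < z"
      using le le_less_trans by blast
    then have "\<forall>y\<in>A. y < z \<longrightarrow> c y < (LEAST w. \<forall>y\<in>A. y < z \<longrightarrow> c y < w)"
      by (rule LeastI)
    then show ?thesis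
      unfolding c [of z, symmetric] using that by blast
  qed
  have inj: "inj_on c A"
    by (rule inj_onI) (metis mono less_irrefl neqE)
  \<comment> \<open>The values of c leave no gaps: minimality of \<open>c z\<close> yields y in A
    below z with \<open>v \<le> c y\<close>, and if the inequality is strict the argument repeats at
    y.\<close>
  have init: "\<exists>y\<in>A. y < z \<and> c y = v" if "v < c z" for v z
    using that
  proof (induction z rule: less_induct)
    case (less z)
    have "\<not> (\<forall>y\<in>A. y < z \<longrightarrow> c y < v)"
      using less.prems unfolding c [of z] by (rule not_less_Least)
    then obtain y where y: "y \<in> A" "y < z" "v \<le> c y" by (meson not_le)
    then show ?case
      using less.IH [of y] by (metis le_less less_trans)
  qed
  have img: "c ` A = seg (c x)"
  proof
    show "c ` A \<subseteq> seg (c x)" using mono assms by auto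
    show "seg (c x) \<subseteq> c ` A" using init [of _ x] by fastforce
  qed
  let ?g = "the_inv_into A c"
  have "bij_betw ?g (seg (c x)) A"
    using inj img bij_betw_the_inv_into unfolding bij_betw_def by metis
  moreover have "strict_mono_on (seg (c x)) ?g"
  proof (rule strict_mono_onI)
    fix v w assume vw: "v \<in> seg (c x)" "w \<in> seg (c x)" "v < w"
    then have "?g v \<in> A" "?g w \<in> A" "c (?g v) = v" "c (?g w) = w"
      using the_inv_into_into [OF inj _ order_refl] f_the_inv_into_f [OF inj] img by auto
    then show "?g v < ?g w"
      using mono vw(3) by (metis less_asym less_irrefl neqE)
  qed
  ultimately show ?thesis
    using that le by blast
qed

text \<open>\<open>cof\<close> compares sets with segments by exact equinumerosity, so a bound on
  size must first become an equinumerous segment; collapsing an injective image of B inside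
  \<open>seg \<kappa>\<close> provides it.\<close>

lemma lepoll_seg_eqpoll:
  fixes \<kappa> :: "'a::wellorder"
  assumes "B \<lesssim> seg \<kappa>"
  obtains e where "e \<le> \<kappa>" and "B \<approx> seg e"
proof -
  obtain g where g: "inj_on g B" "g ` B \<subseteq> seg \<kappa>"
    using assms unfolding lepoll_def by blast
  obtain e h where "e \<le> \<kappa>" "bij_betw h (seg e) (g ` B)"
    using collapse [OF g(2)] by metis
  then show ?thesis
    using that g(1) by (meson eqpoll_def eqpoll_sym eqpoll_trans inj_on_image_eqpoll_self)
qed

lemma bounded_below_cof:
  assumes "B \<subseteq> seg \<gamma>" and "B \<approx> seg e" and "e < cof \<gamma>"
  shows "\<exists>y<\<gamma>. \<forall>b\<in>B. b < y"
proof (rule ccontr)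
  assume "\<not> ?thesis"
  then have "cofinal_in B \<gamma>"
    unfolding cofinal_in_def by (meson not_le)
  then have "cof \<gamma> \<le> e"
    unfolding cof_def using assms(1,2) by (intro Least_le) blast
  then show False using assms(3) by simp
qed

lemma lepoll_bounded_below_cof:
  assumes "B \<subseteq> seg \<gamma>" and "B \<lesssim> seg \<kappa>" and "\<kappa> < cof \<gamma>"
  shows "\<exists>y<\<gamma>. \<forall>b\<in>B. b < y"
  using lepoll_seg_eqpoll [OF assms(2)] bounded_below_cof [OF assms(1)] assms(3) le_less_trans
  by metis

text \<open>A countable B is not equinumerous with the uncountable
  \<open>seg (cof \<gamma>)\<close>, so the segment matching B has index strictly below the
  cofinality.\<close>

lemma countable_bounded_below_cof:
  assumes "countable B" and "B \<subseteq> seg \<gamma>" and "\<not> countable (seg (cof \<gamma>))"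
  shows "\<exists>y<\<gamma>. \<forall>b\<in>B. b < y"
proof -
  have "infinite (seg (cof \<gamma>))"
    using assms(3) countable_finite by blast
  then obtain e where e: "e \<le> cof \<gamma>" "B \<approx> seg e"
    using lepoll_seg_eqpoll countable_lepoll_infinite [OF assms(1)] by metis
  then have "e \<noteq> cof \<gamma>"
    using assms(1,3) countable_eqpoll eqpoll_sym by blast
  then show ?thesis
    using bounded_below_cof assms(2) e by (metis le_neq_trans)
qed

section \<open>Cardinals and cardinal successors\<close>

lemma seg_lesspoll_cardinal:
  assumes "is_cardinal \<kappa>" and "x < \<kappa>"
  shows "seg x \<prec> seg \<kappa>"
  using assms seg_mono [of x \<kappa>] subset_imp_lepoll
  unfolding is_cardinal_def lesspoll_def by (metis eqpoll_def less_imp_le)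

lemma csuc_le: "seg \<kappa> \<prec> seg x \<Longrightarrow> csuc \<kappa> \<le> x"
  unfolding csuc_def by (rule Least_le)

text \<open>The ordinal x witnesses that the minimum defining \<open>csuc\<close> is taken over a
  nonempty class; otherwise its value would be arbitrary.\<close>

lemma seg_lesspoll_csuc:
  fixes \<kappa> x :: "'a::wellorder"
  shows "seg \<kappa> \<prec> seg x \<Longrightarrow> seg \<kappa> \<prec> seg (csuc \<kappa>)"
  unfolding csuc_def by (rule LeastI)

section \<open>Ordinals written as omega * e + k, and the intervals they index\<close>

lemma succ_eqI: "x < y \<Longrightarrow> (\<And>z. x < z \<Longrightarrow> y \<le> z) \<Longrightarrow> succ x = y"
  unfolding succ_def by (rule Least_equality)

text \<open>Let f enumerate the limits below x and g those below x'. By induction g w \<le> f w,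
  since otherwise f w would be a value of g at an earlier argument. So g stays below x and misses x,
  which it ought to list. This makes the definite description in \<open>omega_mul\<close>
  meaningful.\<close>

lemma omega_mul_unique:
  fixes x x' :: "'a::wellorder"
  assumes "ord_iso (seg e) ({y. limit_or_zero y} \<inter> seg x)"
    and "limit_or_zero x" and "x < x'"
  shows "\<not> ord_iso (seg e) ({y. limit_or_zero y} \<inter> seg x')"
proof
  let ?L = "{y::'a. limit_or_zero y}"
  assume "ord_iso (seg e) (?L \<inter> seg x')"
  then obtain g where g: "bij_betw g (seg e) (?L \<inter> seg x')" "strict_mono_on (seg e) g"
    unfolding ord_iso_def by blast
  obtain f where f: "bij_betw f (seg e) (?L \<inter> seg x)" "strict_mono_on (seg e) f"
    using assms(1) unfolding ord_iso_def by blast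
  have ge: "g w \<le> f w" if "w < e" for w
    using that
  proof (induction w rule: less_induct)
    case (less w)
    show ?case
    proof (rule ccontr)
      assume "\<not> g w \<le> f w"
      moreover have "f w \<in> ?L \<inter> seg x'"
        using bij_betw_apply [OF f(1), of w] less.prems assms(3) by auto
      then obtain w' where w': "w' \<in> seg e" "f w = g w'"
        using g(1) unfolding bij_betw_def by blast
      ultimately have "w' < w"
        using strict_mono_on_less [OF g(2), of w' w] less.prems by (simp add: not_le)
      then have "f w' < f w" "g w' \<le> f w'"
        using strict_mono_onD [OF f(2), of w' w] w' less.IH [of w'] less.prems by simp_all
      then show False using w' by simp
    qed
  qed
  have "x \<in> ?L \<inter> seg x'" using assms by simp
  then obtain v where "v \<in> seg e" "g v = x"
    using g(1) unfolding bij_betw_def by (metis imageE)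
  then show False
    using ge bij_betwE [OF f(1)] by fastforce
qed

lemma omega_mul_eq:
  assumes "limit_or_zero x" and "ord_iso (seg e) ({y. limit_or_zero y} \<inter> seg x)"
  shows "omega_mul e = x"
  unfolding omega_mul_def
  proof (rule the_equality)
  fix x' assume "limit_or_zero x' \<and> ord_iso (seg e) ({y. limit_or_zero y} \<inter> seg x')"
  then show "x' = x"
    using assms omega_mul_unique by (metis neqE)
qed (use assms in simp)

lemma not_limit_succ:
  assumes "\<not> limit_or_zero j"
  obtains y where "y < j" and "j = succ y"
  using assms succ_eqI unfolding limit_or_zero_def by (metis not_le)

text \<open>Limits, zero included, are reached with k = 0 by collapsing the set of smaller limits;
  any other ordinal adds one to the k of its predecessor. The bound \<open>e \<le> j\<close> keeps e
  below \<sigma> whenever j is.\<close>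

lemma oidx_surj: "\<exists>e\<le>j. \<exists>k. j = oidx e k"
proof (induction j rule: less_induct)
  case (less j)
  show ?case
  proof (cases "limit_or_zero j")
    case True
    obtain e g where "e \<le> j" "bij_betw g (seg e) ({y. limit_or_zero y} \<inter> seg j)"
      "strict_mono_on (seg e) g"
      using collapse [of "{y. limit_or_zero y} \<inter> seg j" j] by blast
    then have "j = oidx e 0"
      using omega_mul_eq [OF True] unfolding ord_iso_def oidx_def by (metis funpow_0)
    then show ?thesis using \<open>e \<le> j\<close> by blast
  next
    case False
    then obtain y where y: "y < j" "j = succ y"
      by (rule not_limit_succ)
    then obtain e k where "e \<le> y" "y = oidx e k"
      using less.IH by blast
    then have "j = oidx e (Suc k)" "e \<le> j"
      using y by (auto simp: oidx_def)
    then show ?thesis by blast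
  qed
qed

text \<open>The least index j with \<gamma> at or below its club point is a successor, and \<gamma>
  lies in the interval ending at j. At a limit j, the supremum of the earlier club points would
  belong to the club, hence equal \<gamma>, and \<gamma> would accumulate C.\<close>

lemma nacc_in_Iv:
  assumes c0: "strict_mono_on (seg \<sigma>) (c0 \<delta>)" "club_in (c0 \<delta> ` seg \<sigma>) \<delta>"
    and C: "c0 \<delta> ` seg \<sigma> \<subseteq> C"
    and \<gamma>: "\<gamma> < \<delta>" "\<gamma> \<notin> acc C \<delta>"
    and z: "z < \<sigma>" "c0 \<delta> z < \<gamma>"
  shows "\<exists>e<\<sigma>. \<exists>k. \<gamma> \<in> Iv c0 \<delta> e k"
proof -
  let ?c = "c0 \<delta>"
  define j where "j = (LEAST j. j < \<sigma> \<and> \<gamma> \<le> ?c j)"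
  have "\<exists>c\<in>?c ` seg \<sigma>. \<gamma> \<le> c"
    using c0(2) \<gamma>(1) unfolding club_in_def by blast
  then have "\<exists>j. j < \<sigma> \<and> \<gamma> \<le> ?c j" by auto
  then have j: "j < \<sigma>" "\<gamma> \<le> ?c j"
    unfolding j_def using LeastI_ex [of "\<lambda>j. j < \<sigma> \<and> \<gamma> \<le> ?c j"] by blast+
  have below: "?c i < \<gamma>" if "i < j" for i
    using not_less_Least [OF that [unfolded j_def]] that j(1) by (meson less_trans not_le)
  have mono: "?c i < ?c i'" if "i < i'" "i' < \<sigma>" for i i'
    using strict_mono_onD [OF c0(1)] that by auto
  \<comment> \<open>Zero counts as a limit here. The index z keeps j positive, which supplies the
    point below \<alpha> that the closure clause of \<open>club_in\<close> asks for.\<close>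
  have "z < j"
    using mono [of j z] z j(2) by (metis leD less_le_trans less_trans neqE)
  have "\<not> limit_or_zero j"
  proof
    assume lim: "limit_or_zero j"
    define \<alpha> where "\<alpha> = (LEAST a. \<forall>i<j. ?c i < a)"
    have \<alpha>: "\<forall>i<j. ?c i < \<alpha>" "\<alpha> \<le> \<gamma>"
      unfolding \<alpha>_def using below by (auto intro: LeastI2 Least_le)
    have lim\<alpha>: "\<exists>i<j. \<beta> < ?c i \<and> ?c i < \<alpha>" if lt: "\<beta> < \<alpha>" for \<beta>
    proof -
      obtain i where i: "i < j" "\<beta> \<le> ?c i"
        using not_less_Least [OF lt [unfolded \<alpha>_def]] by (meson not_le)
      obtain i' where i': "i < i'" "i' < j"
        using lim i(1) unfolding limit_or_zero_def by blast
      then show ?thesis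
        using mono [of i i'] j(1) i(2) \<alpha>(1) by (meson le_less_trans less_trans)
    qed
    have "\<alpha> < \<delta>" using \<alpha>(2) \<gamma>(1) by simp
    moreover have "\<exists>\<beta>. \<beta> < \<alpha>" using \<alpha>(1) \<open>z < j\<close> by blast
    moreover have "\<forall>\<beta><\<alpha>. \<exists>c\<in>?c ` seg \<sigma>. \<beta> < c \<and> c < \<alpha>"
      using lim\<alpha> j(1) by (meson image_eqI less_trans seg_iff)
    ultimately have "\<alpha> \<in> ?c ` seg \<sigma>" and acc: "\<alpha> \<in> acc C \<delta>"
      using c0(2) C unfolding club_in_def acc_def by blast+
    then obtain j' where j': "j' < \<sigma>" "\<alpha> = ?c j'" by auto
    then have "j \<le> j'" using \<alpha>(1) by (metis less_irrefl not_le)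
    then have "?c j \<le> \<alpha>" using mono j' by (metis le_less)
    then have "\<gamma> = \<alpha>" using j(2) \<alpha>(2) by simp
    then show False using acc \<gamma>(2) by simp
  qed
  then obtain y where y: "y < j" "j = succ y"
    by (rule not_limit_succ)
  obtain e k where ek: "e \<le> y" "y = oidx e k"
    using oidx_surj by blast
  then have "\<gamma> \<in> Iv c0 \<delta> e k"
    using below [OF y(1)] j(2) y(2) unfolding Iv_def by simp
  then show ?thesis
    using ek(1) y(1) j(1) by (meson le_less_trans less_trans)
qed

section \<open>Counting and clubs below the successor of a singular cardinal\<close>

text \<open>The first two assumptions together make the order type of \<open>'a\<close> the cardinal
  successor of the size of \<open>seg \<mu>\<close>.\<close>

locale singular_succ =
  fixes \<mu> :: "'a::wellorder" and \<mu>s :: "nat \<Rightarrow> 'a"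
  assumes lambda_bound: "seg (x::'a) \<lesssim> seg \<mu>"
    and lambda_big: "\<not> ((UNIV :: 'a set) \<lesssim> seg \<mu>)"
    and mus_mono: "strict_mono \<mu>s"
    and mus_regular: "regular (\<mu>s n)"
    and mus_below: "\<mu>s n < \<mu>"
    and mus_cofinal: "y < \<mu> \<Longrightarrow> \<exists>n. y < \<mu>s n"
begin

lemma infinite_seg_mus: "infinite (seg (\<mu>s n))"
  using mus_regular unfolding regular_def by blast

lemma infinite_seg_mu: "infinite (seg \<mu>)"
  using infinite_seg_mus seg_mono mus_below by (meson finite_subset less_imp_le)

lemma insert_seg_lepoll: "insert b (seg b) \<lesssim> seg \<mu>" for b :: 'a
  using insert_lepoll_cong [OF lambda_bound, of \<mu>] infinite_insert_lepoll [OF infinite_seg_mu]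
  by (meson lepoll_trans less_irrefl seg_iff)

text \<open>Regularity of \<lambda>: an unbounded B would cover the type by at most \<mu> segments,
  each of size at most \<mu>.\<close>

lemma bounded:
  fixes B :: "'a set"
  assumes "B \<lesssim> seg \<mu>"
  shows "\<exists>z. \<forall>b\<in>B. b < z"
proof (rule ccontr)
  assume "\<not> ?thesis"
  then have "\<forall>z. \<exists>b\<in>B. z \<le> b" by (meson not_le)
  then have "UNIV = (\<Union>b\<in>B. insert b (seg b))"
    by (auto simp: le_less) blast
  moreover have "(\<Union>b\<in>B. insert b (seg b)) \<lesssim> seg \<mu>"
    by (rule UN_lepoll [OF infinite_seg_mu assms insert_seg_lepoll])
  ultimately show False using lambda_big by (simp only:)
qed

lemma countable_bounded:
  fixes B :: "'a set"
  assumes "countable B"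
  shows "\<exists>z. \<forall>b\<in>B. b < z"
  using bounded countable_lepoll_infinite [OF assms infinite_seg_mu] by blast

text \<open>If each value stopped recurring beyond some bound, regularity of \<lambda> would give a
  common bound z, and the value \<open>h z\<close> would contradict it.\<close>

lemma pigeonhole:
  fixes h :: "'a \<Rightarrow> 'b"
  assumes "range h \<lesssim> seg \<mu>"
  shows "\<exists>k. \<forall>b. \<exists>\<beta>\<ge>b. h \<beta> = k"
proof (rule ccontr)
  assume "\<not> ?thesis"
  then obtain b where b: "\<And>k \<beta>. b k \<le> \<beta> \<Longrightarrow> h \<beta> \<noteq> k" by metis
  obtain z where "\<forall>x\<in>b ` range h. x < z"
    using bounded lepoll_trans [OF image_lepoll assms] by blast
  then show False using b [of "h z" z] by (simp add: less_imp_le)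
qed

lemma mus_bounded:
  assumes "B \<subseteq> seg (\<mu>s n)" and "B \<lesssim> seg \<kappa>" and "\<kappa> < \<mu>s n"
  shows "\<exists>y<\<mu>s n. \<forall>b\<in>B. b < y"
  using lepoll_bounded_below_cof [OF assms(1,2)] assms(3) mus_regular
  unfolding regular_def by metis

lemma mus_lesspoll: "m < n \<Longrightarrow> seg (\<mu>s m) \<prec> seg (\<mu>s n)"
  using seg_lesspoll_cardinal mus_regular mus_mono
  unfolding regular_def strict_mono_def by blast

lemma csuc_mus_le: "csuc (\<mu>s m) \<le> \<mu>s (Suc m)"
  by (rule csuc_le) (simp add: mus_lesspoll)

lemma mus_less_csuc: "\<mu>s m < csuc (\<mu>s m)"
proof (rule ccontr)
  assume "\<not> ?thesis"
  then have "seg (csuc (\<mu>s m)) \<lesssim> seg (\<mu>s m)"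
    by (intro subset_imp_lepoll seg_mono) simp
  moreover have "seg (\<mu>s m) \<prec> seg (csuc (\<mu>s m))"
    using mus_lesspoll [of m "Suc m"] by (intro seg_lesspoll_csuc) simp
  ultimately show False
    using lesspoll_trans1 lesspoll_not_refl by blast
qed

lemma csuc_mus_mono: "k \<le> m \<Longrightarrow> csuc (\<mu>s k) \<le> csuc (\<mu>s m)"
proof (cases "k = m")
  case False
  assume "k \<le> m"
  then have "\<mu>s (Suc k) \<le> \<mu>s m"
    using mus_mono False by (simp add: strict_mono_less_eq)
  then show ?thesis
    using csuc_mus_le mus_less_csuc by (meson less_imp_le order_trans)
qed simp

lemma infinite_seg_csuc: "infinite (seg (csuc (\<mu>s m)))"
  using infinite_seg_mus seg_mono mus_less_csuc by (meson finite_subset less_imp_le)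

lemma club_closure_points:
  fixes \<psi> :: "'a \<Rightarrow> 'a"
  shows "club {x. \<forall>\<beta><x. \<psi> \<beta> < x}"
proof -
  \<comment> \<open>A segment has at most \<mu> points, so \<psi> can be dominated on all of it at
    once; g below is such a bound.\<close>
  have "\<exists>y. x < y \<and> (\<forall>z\<le>x. \<psi> z < y)" for x
  proof -
    have "(\<psi> ` seg x) \<lesssim> seg \<mu>"
      using image_lepoll lambda_bound by (rule lepoll_trans)
    then obtain y1 where "\<forall>b\<in>\<psi> ` seg x. b < y1"
      using bounded by blast
    moreover obtain y2 where "\<forall>b\<in>{x, \<psi> x, y1}. b < y2"
      using countable_bounded [of "{x, \<psi> x, y1}"] by auto
    ultimately show ?thesis
      by (intro exI [of _ y2]) (auto simp: le_less intro: less_trans)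
  qed
  then obtain g where g: "\<And>x. x < g x" "\<And>x z. z \<le> x \<Longrightarrow> \<psi> z < g x"
    by metis
  have "\<exists>e\<in>{x. \<forall>\<beta><x. \<psi> \<beta> < x}. \<beta> < e" for \<beta>
  proof -
    \<comment> \<open>The closure point is the supremum of the iterates of g: whatever lies below it
      is at or below some iterate, and the next iterate exceeds its image under \<psi>.\<close>
    define X where "X k = (g ^^ k) \<beta>" for k :: nat
    define e where "e = (LEAST z. \<forall>k. X k < z)"
    have "\<exists>z. \<forall>k. X k < z"
      using countable_bounded [of "range X"] by auto
    then have e: "X k < e" for k
      unfolding e_def using LeastI_ex [of "\<lambda>z. \<forall>k. X k < z"] by blast
    have "\<psi> y < e" if lt: "y < e" for y
    proof -
      obtain k where "y \<le> X k"
        using not_less_Least [OF lt [unfolded e_def]] by (meson not_le)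
      then have "\<psi> y < X (Suc k)"
        using g(2) by (simp add: X_def)
      then show ?thesis using e less_trans by blast
    qed
    moreover have "\<beta> < e" using e [of 0] by (simp add: X_def)
    ultimately show ?thesis by blast
  qed
  moreover have "\<psi> \<beta> < \<alpha>" if "\<beta> < \<alpha>"
      "\<forall>\<beta><\<alpha>. \<exists>e\<in>{x. \<forall>\<beta><x. \<psi> \<beta> < x}. \<beta> < e \<and> e < \<alpha>" for \<alpha> \<beta>
    using that less_trans by blast
  ultimately show ?thesis
    unfolding club_def by blast
qed

end

section \<open>The scale and the last crossing of two of its functions\<close>

locale scale = singular_succ \<mu> \<mu>s for \<mu> :: "'a::wellorder" and \<mu>s +
  fixes f :: "'a \<Rightarrow> nat \<Rightarrow> 'a"
  assumes f_less: "f \<alpha> n < \<mu>s n"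
    and f_incr: "\<alpha> < \<beta> \<Longrightarrow> \<forall>\<^sub>F n in sequentially. f \<alpha> n < f \<beta> n"
    and f_cofinal: "(\<And>n. g n < \<mu>s n) \<Longrightarrow> \<exists>\<alpha>. \<forall>\<^sub>F n in sequentially. g n \<le> f \<alpha> n"
begin

text \<open>The last coordinate at which f \<zeta> exceeds f \<xi>; arbitrary if there is none.\<close>

definition lev :: "'a \<Rightarrow> 'a \<Rightarrow> nat" where
  "lev \<zeta> \<xi> = (THE m. f \<xi> m < f \<zeta> m \<and> (\<forall>n>m. f \<zeta> n \<le> f \<xi> n))"

lemma lev_eq:
  assumes "f \<xi> m < f \<zeta> m" and "\<And>n. m < n \<Longrightarrow> f \<zeta> n \<le> f \<xi> n"
  shows "lev \<zeta> \<xi> = m"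
  unfolding lev_def using assms by (intro the_equality) (auto, meson leD neqE)

text \<open>This replaces the indexed disjoint sequence of the theorem: members lie arbitrarily
  high, and subfamilies obtained by the pigeonhole principle have the same form.\<close>

definition cofinal_family :: "'a set set \<Rightarrow> bool" where
  "cofinal_family F \<longleftrightarrow> (\<forall>u\<in>F. finite u) \<and> (\<forall>\<beta>. \<exists>u\<in>F. \<forall>x\<in>u. \<beta> < x)"

text \<open>Otherwise infinitely many coordinates m carry a bound \<open>h m\<close> that no member
  of F above \<open>b m\<close> exceeds at all its points. These bounds lie in the product, so some
  \<open>f \<alpha>\<close> dominates them eventually; a member of F above \<alpha> and all
  \<open>b m\<close> then eventually exceeds them, a contradiction.\<close>

lemma high_values:
  assumes F: "cofinal_family F"
  shows "\<exists>n0. \<forall>m\<ge>n0. \<forall>\<eta><\<mu>s m. \<forall>\<beta>. \<exists>u\<in>F. \<forall>\<zeta>\<in>u. \<beta> < \<zeta> \<and> \<eta> < f \<zeta> m"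
proof (rule ccontr)
  define bad where "bad m \<eta> \<beta> \<longleftrightarrow>
    \<eta> < \<mu>s m \<and> (\<forall>u\<in>F. (\<forall>\<zeta>\<in>u. \<beta> < \<zeta>) \<longrightarrow> (\<exists>\<zeta>\<in>u. f \<zeta> m \<le> \<eta>))" for m \<eta> \<beta>
  assume "\<not> ?thesis"
  then have often: "\<exists>m\<ge>n0. \<exists>\<eta> \<beta>. bad m \<eta> \<beta>" for n0
    unfolding bad_def by (meson not_le)
  define h where "h m = (SOME \<eta>. \<exists>\<beta>. bad m \<eta> \<beta>)" for m
  define b where "b m = (SOME \<beta>. bad m (h m) \<beta>)" for m
  have hb: "bad m (h m) (b m)" if "\<exists>\<eta> \<beta>. bad m \<eta> \<beta>" for m
    unfolding b_def using someI_ex [OF that, folded h_def] by (rule someI_ex)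
  \<comment> \<open>At coordinates without a bad bound, g only has to stay in the product;
    \<open>f \<mu> m\<close> is an arbitrary choice.\<close>
  define g where "g m = (if \<exists>\<eta> \<beta>. bad m \<eta> \<beta> then h m else f \<mu> m)" for m
  have "g m < \<mu>s m" for m
    using hb [of m] f_less unfolding g_def bad_def by auto
  then obtain \<alpha> where \<alpha>: "\<forall>\<^sub>F n in sequentially. g n \<le> f \<alpha> n"
    using f_cofinal by blast
  obtain z where z: "\<forall>x\<in>insert \<alpha> (range b). x < z"
    using countable_bounded [of "insert \<alpha> (range b)"] by auto
  obtain u where u: "u \<in> F" "\<forall>\<zeta>\<in>u. z < \<zeta>" "finite u"
    using F unfolding cofinal_family_def by blast
  have "\<forall>\<^sub>F n in sequentially. f \<alpha> n < f \<zeta> n" if "\<zeta> \<in> u" for \<zeta>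
    using f_incr u(2) z that by (meson insertI1 less_trans)
  then have "\<forall>\<^sub>F n in sequentially. \<forall>\<zeta>\<in>u. f \<alpha> n < f \<zeta> n"
    using u(3) by (simp add: eventually_ball_finite)
  with \<alpha> have "\<forall>\<^sub>F n in sequentially. \<forall>\<zeta>\<in>u. g n < f \<zeta> n"
    by eventually_elim (meson le_less_trans)
  then obtain N where N: "\<And>n \<zeta>. N \<le> n \<Longrightarrow> \<zeta> \<in> u \<Longrightarrow> g n < f \<zeta> n"
    unfolding eventually_sequentially by blast
  obtain m where m: "N \<le> m" "\<exists>\<eta> \<beta>. bad m \<eta> \<beta>"
    using often by blast
  have "\<forall>\<zeta>\<in>u. b m < \<zeta>" using z u(2) by (meson insertI2 less_trans rangeI)
  then obtain \<zeta> where "\<zeta> \<in> u" "f \<zeta> m \<le> h m"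
    using hb [OF m(2)] u(1) unfolding bad_def by blast
  moreover have "g m = h m" using m(2) by (auto simp: g_def)
  ultimately show False
    using N [OF m(1)] by (metis leD)
qed

text \<open>The level is forced from two sides. A set \<open>w m \<eta> \<beta>\<close> has values
  above \<eta> at m, so it exceeds each \<open>f \<xi>\<close> there once \<eta> is large enough.
  Beyond m its values stay below \<open>h \<beta>\<close>, which \<open>f \<xi>\<close> eventually
  dominates.\<close>

lemma lev_control:
  assumes F: "cofinal_family F"
  obtains E where "club E"
    and "\<forall>\<delta>\<in>E. \<forall>\<beta><\<delta>. \<exists>u\<in>F. \<forall>x\<in>u. \<beta> < x \<and> x < \<delta>"
    and "\<forall>\<delta>\<in>E. \<forall>U. \<not> countable (seg (cof \<delta>)) \<and> finite U \<and> (\<forall>\<xi>\<in>U. \<delta> < \<xi>) \<longrightarrow>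
      (\<exists>M. \<forall>m\<ge>M. \<forall>\<beta><\<delta>. \<exists>u\<in>F. \<forall>\<zeta>\<in>u. \<beta> < \<zeta> \<and> \<zeta> < \<delta> \<and> (\<forall>\<xi>\<in>U. lev \<zeta> \<xi> = m))"
proof -
  obtain n0 where "\<forall>m\<ge>n0. \<forall>\<eta><\<mu>s m. \<forall>\<beta>. \<exists>u\<in>F. \<forall>\<zeta>\<in>u. \<beta> < \<zeta> \<and> \<eta> < f \<zeta> m"
    using high_values [OF F] by blast
  then have "\<forall>m \<eta> \<beta>. \<exists>u. n0 \<le> m \<and> \<eta> < \<mu>s m \<longrightarrow> u \<in> F \<and> (\<forall>\<zeta>\<in>u. \<beta> < \<zeta> \<and> \<eta> < f \<zeta> m)"
    by blast
  then obtain w where w: "\<And>m \<eta> \<beta>. n0 \<le> m \<Longrightarrow> \<eta> < \<mu>s m \<Longrightarrow>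
      w m \<eta> \<beta> \<in> F \<and> (\<forall>\<zeta>\<in>w m \<eta> \<beta>. \<beta> < \<zeta> \<and> \<eta> < f \<zeta> m)"
    by metis
  have fin: "finite (w m \<eta> \<beta>)" if "n0 \<le> m" "\<eta> < \<mu>s m" for m \<eta> \<beta>
    using w [OF that] F unfolding cofinal_family_def by blast
  \<comment> \<open>For n = k + 1 only \<open>\<mu>s k\<close> many finite sets compete at
    coordinate n, and \<open>\<mu>s n\<close> is regular. For n = 0 there is no smaller m, so any
    value will do.\<close>
  have "\<exists>y<\<mu>s n. \<forall>m \<eta> \<zeta>. n0 \<le> m \<and> m < n \<and> \<eta> < \<mu>s m \<and> \<zeta> \<in> w m \<eta> \<beta> \<longrightarrow> f \<zeta> n < y" for n \<beta>
  proof (cases n)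
    case 0
    then show ?thesis using f_less by blast
  next
    case (Suc k)
    let ?I = "Sigma {n0..<n} (\<lambda>m. seg (\<mu>s m))"
    let ?B = "\<Union>(m, \<eta>)\<in>?I. (\<lambda>\<zeta>. f \<zeta> n) ` w m \<eta> \<beta>"
    have "seg (\<mu>s m) \<lesssim> seg (\<mu>s k)" if "m < n" for m
      using that mus_mono Suc
      by (intro subset_imp_lepoll seg_mono) (simp add: strict_mono_less_eq)
    then have "?I \<lesssim> {n0..<n} \<times> seg (\<mu>s k)"
      by (intro Sigma_lepoll_mono) auto
    also have "\<dots> \<lesssim> seg (\<mu>s k)"
      using infinite_seg_mus by (intro Times_lepoll finite_lepoll_infinite lepoll_refl) auto
    finally have "?B \<lesssim> seg (\<mu>s k)"
      using fin infinite_seg_mus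
      by (intro UN_lepoll [where I = ?I] finite_lepoll_infinite [where B = "_ ` _"])
        (auto intro!: finite_lepoll_infinite)
    moreover have "?B \<subseteq> seg (\<mu>s n)" using f_less by auto
    moreover have "\<mu>s k < \<mu>s n" using Suc mus_mono by (simp add: strict_mono_less)
    ultimately obtain y where "y < \<mu>s n" "\<forall>b\<in>?B. b < y"
      using mus_bounded by blast
    then show ?thesis by (intro exI [of _ y]) auto
  qed
  then have "\<forall>\<beta> n. \<exists>y. y < \<mu>s n \<and>
      (\<forall>m \<eta> \<zeta>. n0 \<le> m \<and> m < n \<and> \<eta> < \<mu>s m \<and> \<zeta> \<in> w m \<eta> \<beta> \<longrightarrow> f \<zeta> n < y)"
    by blast
  then have "\<exists>h. \<forall>\<beta> n. h \<beta> n < \<mu>s n \<and>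
      (\<forall>m \<eta> \<zeta>. n0 \<le> m \<and> m < n \<and> \<eta> < \<mu>s m \<and> \<zeta> \<in> w m \<eta> \<beta> \<longrightarrow> f \<zeta> n < h \<beta> n)"
    unfolding choice_iff .
  then obtain h where h: "\<And>\<beta> n. h \<beta> n < \<mu>s n"
    "\<And>\<beta> n m \<eta> \<zeta>. n0 \<le> m \<Longrightarrow> m < n \<Longrightarrow> \<eta> < \<mu>s m \<Longrightarrow> \<zeta> \<in> w m \<eta> \<beta> \<Longrightarrow> f \<zeta> n < h \<beta> n"
    by blast
  have "\<exists>\<alpha>. \<forall>\<^sub>F n in sequentially. h \<beta> n \<le> f \<alpha> n" for \<beta>
    by (rule f_cofinal) (rule h)
  then obtain \<phi> where \<phi>: "\<And>\<beta>. \<forall>\<^sub>F n in sequentially. h \<beta> n \<le> f (\<phi> \<beta>) n"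
    by metis
  have "\<exists>y. \<phi> \<beta> < y \<and> (\<forall>m \<eta> \<zeta>. n0 \<le> m \<longrightarrow> \<eta> < \<mu>s m \<longrightarrow> \<zeta> \<in> w m \<eta> \<beta> \<longrightarrow> \<zeta> < y)" for \<beta>
  proof -
    have "(\<Union>\<eta>\<in>seg (\<mu>s m). w m \<eta> \<beta>) \<lesssim> seg \<mu>" if "m \<in> {n0..}" for m
      by (rule UN_lepoll [OF infinite_seg_mu lambda_bound])
        (use fin that in \<open>auto intro!: finite_lepoll_infinite [OF infinite_seg_mu]\<close>)
    then have "(\<Union>m\<in>{n0..}. \<Union>\<eta>\<in>seg (\<mu>s m). w m \<eta> \<beta>) \<lesssim> seg \<mu>"
      by (rule UN_lepoll [OF infinite_seg_mu countable_lepoll_infinite [OF _ infinite_seg_mu], rotated])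
        (auto intro: countableI_type)
    then obtain y where y: "\<forall>x\<in>(\<Union>m\<in>{n0..}. \<Union>\<eta>\<in>seg (\<mu>s m). w m \<eta> \<beta>). x < y"
      using bounded by blast
    have "\<zeta> < y" if "n0 \<le> m" "\<eta> < \<mu>s m" "\<zeta> \<in> w m \<eta> \<beta>" for m \<eta> \<zeta>
      using y that by (meson UN_I atLeast_iff seg_iff)
    moreover obtain y' where "\<phi> \<beta> < y'" "y < y'"
      using countable_bounded [of "{\<phi> \<beta>, y}"] by auto
    ultimately show ?thesis
      by (intro exI [of _ y']) (meson less_trans)
  qed
  then obtain \<psi> where \<psi>: "\<And>\<beta>. \<phi> \<beta> < \<psi> \<beta>"
    "\<And>\<beta> m \<eta> \<zeta>. n0 \<le> m \<Longrightarrow> \<eta> < \<mu>s m \<Longrightarrow> \<zeta> \<in> w m \<eta> \<beta> \<Longrightarrow> \<zeta> < \<psi> \<beta>"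
    by metis
  \<comment> \<open>Closure under \<psi> places both the index \<open>\<phi> \<beta>\<close> of the
    dominating scale function and all sets \<open>w m \<eta> \<beta>\<close> below \<delta>.\<close>
  define E where "E = {x. \<forall>\<beta><x. \<psi> \<beta> < x}"
  have wE: "\<forall>x\<in>w m \<eta> \<beta>. \<beta> < x \<and> x < \<delta>" "w m \<eta> \<beta> \<in> F"
    if "\<delta> \<in> E" "\<beta> < \<delta>" "n0 \<le> m" "\<eta> < \<mu>s m" for \<delta> \<beta> m \<eta>
    using w [of m \<eta> \<beta>] \<psi>(2) [of m \<eta> _ \<beta>] that less_trans unfolding E_def by blast+
  show ?thesis
  proof
    show "club E" unfolding E_def by (rule club_closure_points)
    show "\<forall>\<delta>\<in>E. \<forall>\<beta><\<delta>. \<exists>u\<in>F. \<forall>x\<in>u. \<beta> < x \<and> x < \<delta>"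
    proof (intro ballI allI impI)
      fix \<delta> \<beta> assume "\<delta> \<in> E" "\<beta> < \<delta>"
      then show "\<exists>u\<in>F. \<forall>x\<in>u. \<beta> < x \<and> x < \<delta>"
        using wE [of \<delta> \<beta> n0 "f \<beta> n0"] f_less by blast
    qed
    show "\<forall>\<delta>\<in>E. \<forall>U. \<not> countable (seg (cof \<delta>)) \<and> finite U \<and> (\<forall>\<xi>\<in>U. \<delta> < \<xi>) \<longrightarrow>
      (\<exists>M. \<forall>m\<ge>M. \<forall>\<beta><\<delta>. \<exists>u\<in>F. \<forall>\<zeta>\<in>u. \<beta> < \<zeta> \<and> \<zeta> < \<delta> \<and> (\<forall>\<xi>\<in>U. lev \<zeta> \<xi> = m))"
    proof (intro ballI allI impI, elim conjE)
      fix \<delta> U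
      assume \<delta>: "\<delta> \<in> E" "\<not> countable (seg (cof \<delta>))" and U: "finite U" "\<forall>\<xi>\<in>U. \<delta> < \<xi>"
      define good where "good k \<beta> \<longleftrightarrow> (\<forall>n\<ge>k. \<forall>\<xi>\<in>U. h \<beta> n \<le> f \<xi> n)" for k \<beta>
      have good_ex: "\<exists>k. good k \<beta>" if "\<beta> < \<delta>" for \<beta>
      proof -
        have "\<phi> \<beta> < \<delta>" using \<delta>(1) that \<psi>(1) less_trans unfolding E_def by blast
        then have "\<forall>\<^sub>F n in sequentially. f (\<phi> \<beta>) n < f \<xi> n" if "\<xi> \<in> U" for \<xi>
          using f_incr U(2) that by (meson less_trans)
        then have "\<forall>\<^sub>F n in sequentially. \<forall>\<xi>\<in>U. f (\<phi> \<beta>) n < f \<xi> n"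
          using U(1) by (simp add: eventually_ball_finite)
        with \<phi> [of \<beta>] have "\<forall>\<^sub>F n in sequentially. \<forall>\<xi>\<in>U. h \<beta> n \<le> f \<xi> n"
          by eventually_elim (meson le_less_trans less_imp_le)
        then show ?thesis
          unfolding eventually_sequentially good_def by blast
      qed
      \<comment> \<open>The coordinate from which \<open>h \<beta>\<close> is dominated depends on
        \<beta>. If no single k worked cofinally often, countably many bounds \<open>b k\<close>
        would have a common bound below \<delta>, by its uncountable cofinality.\<close>
      have "\<exists>k. \<forall>\<beta><\<delta>. \<exists>\<beta>'. \<beta> \<le> \<beta>' \<and> \<beta>' < \<delta> \<and> good k \<beta>'"
      proof (rule ccontr)
        assume "\<not> ?thesis"
        then obtain b where b: "\<And>k. b k < \<delta>" "\<And>k \<beta>'. b k \<le> \<beta>' \<Longrightarrow> \<beta>' < \<delta> \<Longrightarrow> \<not> good k \<beta>'"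
          by metis
        have "range b \<subseteq> seg \<delta>" using b(1) by auto
        then obtain y where "y < \<delta>" "\<forall>x\<in>range b. x < y"
          using countable_bounded_below_cof [OF _ _ \<delta>(2)] by (meson countable_image countableI_type)
        then show False using good_ex [of y] b(2) by (meson less_imp_le rangeI)
      qed
      then obtain k where k: "\<And>\<beta>. \<beta> < \<delta> \<Longrightarrow> \<exists>\<beta>'. \<beta> \<le> \<beta>' \<and> \<beta>' < \<delta> \<and> good k \<beta>'" by blast
      have "\<exists>u\<in>F. \<forall>\<zeta>\<in>u. \<beta> < \<zeta> \<and> \<zeta> < \<delta> \<and> (\<forall>\<xi>\<in>U. lev \<zeta> \<xi> = m)"
        if m: "m \<ge> max n0 k" and "\<beta> < \<delta>" for m \<beta>
      proof -
        obtain \<beta>' where \<beta>': "\<beta> \<le> \<beta>'" "\<beta>' < \<delta>" "good k \<beta>'"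
          using k [OF \<open>\<beta> < \<delta>\<close>] by blast
        \<comment> \<open>Inserting \<beta> keeps the maximum meaningful when U is empty.\<close>
        define \<eta> where "\<eta> = Max ((\<lambda>\<xi>. f \<xi> m) ` insert \<beta> U)"
        have "\<eta> \<in> (\<lambda>\<xi>. f \<xi> m) ` insert \<beta> U"
          unfolding \<eta>_def using U(1) by (intro Max_in) auto
        then have "\<eta> < \<mu>s m" using f_less by auto
        have \<eta>: "f \<xi> m \<le> \<eta>" if "\<xi> \<in> U" for \<xi>
          unfolding \<eta>_def using U(1) that by (intro Max_ge) auto
        have "lev \<zeta> \<xi> = m" if "\<zeta> \<in> w m \<eta> \<beta>'" "\<xi> \<in> U" for \<zeta> \<xi>
        proof (rule lev_eq)
          show "f \<xi> m < f \<zeta> m"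
            using w [of m \<eta> \<beta>'] \<eta> m \<open>\<eta> < \<mu>s m\<close> that by (meson le_less_trans max.boundedE)
          show "f \<zeta> n \<le> f \<xi> n" if "m < n" for n
            using h(2) [of m n \<eta> \<zeta> \<beta>'] \<beta>'(3) m \<open>\<eta> < \<mu>s m\<close> \<open>\<zeta> \<in> w m \<eta> \<beta>'\<close> \<open>\<xi> \<in> U\<close> that
            unfolding good_def by (meson less_imp_le max.boundedE order_trans)
        qed
        then show ?thesis
          using wE [OF \<delta>(1) \<beta>'(2), of m \<eta>] \<beta>'(1) m \<open>\<eta> < \<mu>s m\<close>
          by (meson le_less_trans max.boundedE)
      qed
      then show "\<exists>M. \<forall>m\<ge>M. \<forall>\<beta><\<delta>. \<exists>u\<in>F. \<forall>\<zeta>\<in>u. \<beta> < \<zeta> \<and> \<zeta> < \<delta> \<and> (\<forall>\<xi>\<in>U. lev \<zeta> \<xi> = m)"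
        by blast
    qed
  qed
qed

end

section \<open>The club system, its hulls, and positive sets\<close>

locale club_system = singular_succ \<mu> \<mu>s for \<mu> :: "'a::wellorder" and \<mu>s +
  fixes \<sigma> :: 'a and S :: "'a set" and c0 :: "'a \<Rightarrow> 'a \<Rightarrow> 'a" and C :: "'a \<Rightarrow> 'a set"
  assumes sigma_uncountable: "\<not> countable (seg \<sigma>)"
    and sigma_below: "\<sigma> < \<mu>s 0"
    and S_cof: "\<delta> \<in> S \<Longrightarrow> cof \<delta> = \<sigma>"
    and c0_mono: "\<delta> \<in> S \<Longrightarrow> strict_mono_on (seg \<sigma>) (c0 \<delta>)"
    and c0_club: "\<delta> \<in> S \<Longrightarrow> club_in (c0 \<delta> ` seg \<sigma>) \<delta>"
    and C_club: "\<delta> \<in> S \<Longrightarrow> club_in (C \<delta>) \<delta>"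
    and c0_C: "\<delta> \<in> S \<Longrightarrow> c0 \<delta> ` seg \<sigma> \<subseteq> C \<delta>"
    and C_size: "\<delta> \<in> S \<Longrightarrow> e < \<sigma> \<Longrightarrow> C \<delta> \<inter> Iv c0 \<delta> e m \<lesssim> seg (csuc (\<mu>s m))"
    and C_nacc: "\<delta> \<in> S \<Longrightarrow> e < \<sigma> \<Longrightarrow> \<alpha> \<in> nacc (C \<delta>) \<delta> \<inter> Iv c0 \<delta> e m \<Longrightarrow> csuc (\<mu>s m) < cof \<alpha>"
begin

text \<open>This injection has two uses: it cuts \<xi> into the small pieces
  \<open>part \<xi> m\<close>, and later it names an arbitrary colour below \<xi> by an ordinal
  below \<mu>.\<close>

definition code :: "'a \<Rightarrow> 'a \<Rightarrow> 'a" where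
  "code \<xi> = (SOME h. inj_on h (seg \<xi>) \<and> h ` seg \<xi> \<subseteq> seg \<mu>)"

lemma code: "inj_on (code \<xi>) (seg \<xi>)" "code \<xi> ` seg \<xi> \<subseteq> seg \<mu>"
  using someI_ex [OF lambda_bound [of \<xi>, unfolded lepoll_def]] unfolding code_def by auto

definition part :: "'a \<Rightarrow> nat \<Rightarrow> 'a set" where
  "part \<xi> m = {x \<in> seg \<xi>. code \<xi> x < \<mu>s m}"

text \<open>If \<delta> lies in \<open>part \<xi> m\<close>, then \<open>hull \<xi> m\<close> swallows the part of \<open>C \<delta>\<close> in the
  intervals with second index at most m, so a point \<open>\<gamma>\<close> of it with cofinality above
  \<open>csuc (\<mu>s m)\<close> is isolated from below in \<open>hull \<xi> m\<close>.\<close>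

definition hull :: "'a \<Rightarrow> nat \<Rightarrow> 'a set" where
  "hull \<xi> m = (\<Union>\<delta>\<in>S \<inter> part \<xi> m. \<Union>e\<in>seg \<sigma>. \<Union>k\<in>{..m}. C \<delta> \<inter> Iv c0 \<delta> e k)"

definition nxt :: "'a \<Rightarrow> nat \<Rightarrow> 'a \<Rightarrow> 'a" where
  "nxt \<xi> m \<epsilon> = (LEAST x. x \<in> hull \<xi> m \<and> \<epsilon> \<le> x)"

lemma part_lepoll: "part \<xi> m \<lesssim> seg (\<mu>s m)"
  unfolding lepoll_def part_def
  by (intro exI [of _ "code \<xi>"] conjI inj_on_subset [OF code(1)]) auto

lemma part_cofinal: "x < \<xi> \<Longrightarrow> \<exists>k. \<forall>m\<ge>k. x \<in> part \<xi> m"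
proof -
  assume "x < \<xi>"
  then have "code \<xi> x < \<mu>" using code(2) by fastforce
  then obtain k where "code \<xi> x < \<mu>s k" using mus_cofinal by blast
  then have "\<forall>m\<ge>k. code \<xi> x < \<mu>s m"
    using mus_mono by (meson less_le_trans strict_mono_less_eq)
  then show ?thesis using \<open>x < \<xi>\<close> unfolding part_def by auto
qed

text \<open>The union runs over at most \<open>\<mu>s m\<close> many \<delta>, \<sigma> many e and
  finitely many k, and monotonicity of \<open>csuc\<close> along the sequence bounds every piece by
  the same cardinal.\<close>

lemma hull_lepoll: "hull \<xi> m \<lesssim> seg (csuc (\<mu>s m))"
proof -
  have inf: "infinite (seg (csuc (\<mu>s m)))" by (rule infinite_seg_csuc)
  have "S \<inter> part \<xi> m \<lesssim> seg (\<mu>s m)"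
    using part_lepoll by (meson inf_le2 lepoll_trans subset_imp_lepoll)
  also have "\<dots> \<lesssim> seg (csuc (\<mu>s m))"
    by (intro subset_imp_lepoll seg_mono less_imp_le mus_less_csuc)
  finally have 1: "S \<inter> part \<xi> m \<lesssim> seg (csuc (\<mu>s m))" .
  have "\<mu>s 0 \<le> \<mu>s m" using mus_mono by (simp add: strict_mono_less_eq)
  then have 2: "seg \<sigma> \<lesssim> seg (csuc (\<mu>s m))"
    using sigma_below mus_less_csuc [of m] by (intro subset_imp_lepoll seg_mono) simp
  have 3: "C \<delta> \<inter> Iv c0 \<delta> e k \<lesssim> seg (csuc (\<mu>s m))"
    if "\<delta> \<in> S" "e < \<sigma>" "k \<le> m" for \<delta> e k
    using C_size [OF that(1,2)] subset_imp_lepoll [OF seg_mono [OF csuc_mus_mono [OF that(3)]]]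
    by (rule lepoll_trans)
  have 4: "(\<Union>k\<in>{..m}. C \<delta> \<inter> Iv c0 \<delta> e k) \<lesssim> seg (csuc (\<mu>s m))"
    if "\<delta> \<in> S" "e < \<sigma>" for \<delta> e
    using 3 [OF that] by (intro UN_lepoll [OF inf finite_lepoll_infinite [OF inf]]) auto
  have 5: "(\<Union>e\<in>seg \<sigma>. \<Union>k\<in>{..m}. C \<delta> \<inter> Iv c0 \<delta> e k) \<lesssim> seg (csuc (\<mu>s m))"
    if "\<delta> \<in> S" for \<delta>
    using 4 [OF that] by (intro UN_lepoll [OF inf 2]) auto
  show ?thesis
    unfolding hull_def using 5 by (intro UN_lepoll [OF inf 1]) auto
qed

text \<open>The hull below \<gamma> has fewer than \<open>cof \<gamma>\<close> points, hence is
  bounded by some y below \<gamma>; from anywhere between, the next hull point is \<gamma>.\<close>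

lemma nxt_eq:
  assumes "\<gamma> \<in> hull \<xi> m" and "csuc (\<mu>s m) < cof \<gamma>"
  shows "\<exists>y<\<gamma>. \<forall>\<epsilon>. y < \<epsilon> \<and> \<epsilon> < \<gamma> \<longrightarrow> nxt \<xi> m \<epsilon> = \<gamma>"
proof -
  have "hull \<xi> m \<inter> seg \<gamma> \<lesssim> seg (csuc (\<mu>s m))"
    using hull_lepoll by (meson inf_le1 lepoll_trans subset_imp_lepoll)
  then obtain y where y: "y < \<gamma>" "\<forall>b\<in>hull \<xi> m \<inter> seg \<gamma>. b < y"
    using lepoll_bounded_below_cof [OF _ _ assms(2), of "hull \<xi> m \<inter> seg \<gamma>"] by auto
  have "nxt \<xi> m \<epsilon> = \<gamma>" if "y < \<epsilon>" "\<epsilon> < \<gamma>" for \<epsilon>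
    unfolding nxt_def
  proof (rule Least_equality)
    fix x assume "x \<in> hull \<xi> m \<and> \<epsilon> \<le> x"
    then show "\<gamma> \<le> x" using y(2) that(1) by (metis IntI leI less_asym less_le_trans seg_iff)
  qed (use assms(1) that in auto)
  then show ?thesis using y(1) by blast
qed

text \<open>Without such a point, A would be contained in the single generator of the ideal given by
  a and b.\<close>

lemma positive_large:
  assumes "\<delta> \<in> S" and "A \<subseteq> C \<delta>" and "A \<notin> Idelta \<mu> C \<delta>" and "a < \<mu>" and "b < \<delta>"
  shows "\<exists>\<gamma>\<in>A. \<gamma> \<notin> acc (C \<delta>) \<delta> \<and> a \<le> cof \<gamma> \<and> b \<le> \<gamma>"
proof (rule ccontr)
  let ?G = "{\<gamma> \<in> C \<delta>. \<gamma> \<in> acc (C \<delta>) \<delta> \<or> cof \<gamma> < a \<or> \<gamma> < b}"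
  assume "\<not> ?thesis"
  then have "A \<subseteq> ?G" using assms(2) by fastforce
  then have "A \<in> Idelta \<mu> C \<delta>"
    unfolding Idelta_def gen_ideal_def using assms(2,4,5)
    by (auto intro!: exI [of _ "{?G}"])
  then show False using assms(3) by blast
qed

lemma capture:
  assumes "Q \<notin> idp \<mu> S C" and E: "club E"
  obtains \<delta> where "\<delta> \<in> S \<inter> E"
    and "\<forall>U M. finite U \<and> (\<forall>\<xi>\<in>U. \<delta> < \<xi>) \<longrightarrow> (\<exists>m\<ge>M. \<exists>\<gamma>\<in>E \<inter> Q. \<gamma> < \<delta> \<and>
      (\<exists>y<\<gamma>. \<forall>\<xi>\<in>U. \<forall>\<epsilon>. y < \<epsilon> \<and> \<epsilon> < \<gamma> \<longrightarrow> nxt \<xi> m \<epsilon> = \<gamma>))"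
proof -
  obtain \<delta> where \<delta>: "\<delta> \<in> S \<inter> E" "Q \<inter> E \<inter> C \<delta> \<notin> Idelta \<mu> C \<delta>"
    using assms unfolding idp_def by blast
  then have \<delta>S: "\<delta> \<in> S" by simp
  have "infinite (seg \<sigma>)" using sigma_uncountable countable_finite by blast
  \<comment> \<open>Two indices are taken so that \<gamma>, chosen at or above the point of index
    z', lies strictly above the one of index z, as \<open>nacc_in_Iv\<close> requires.\<close>
  have "\<exists>z. z < \<sigma> \<and> (\<exists>z'. z' < \<sigma> \<and> z < z')"
  proof -
    obtain X where "X \<subseteq> seg \<sigma>" "card X = 2"
      using infinite_arbitrarily_large [OF \<open>infinite (seg \<sigma>)\<close>] by blast
    then show ?thesis
      unfolding card_2_iff by (metis insertCI linorder_neqE seg_iff subsetD)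
  qed
  then obtain z z' where z: "z < \<sigma>" "z' < \<sigma>" "z < z'" by blast
  have c0z: "c0 \<delta> z < c0 \<delta> z'"
    using strict_mono_onD [OF c0_mono [OF \<delta>S]] z by simp
  have z'\<delta>: "c0 \<delta> z' < \<delta>"
    using c0_club [OF \<delta>S] z(2) unfolding club_in_def by fastforce
  show ?thesis
  proof
    show "\<delta> \<in> S \<inter> E" by (rule \<delta>(1))
    show "\<forall>U M. finite U \<and> (\<forall>\<xi>\<in>U. \<delta> < \<xi>) \<longrightarrow> (\<exists>m\<ge>M. \<exists>\<gamma>\<in>E \<inter> Q. \<gamma> < \<delta> \<and>
      (\<exists>y<\<gamma>. \<forall>\<xi>\<in>U. \<forall>\<epsilon>. y < \<epsilon> \<and> \<epsilon> < \<gamma> \<longrightarrow> nxt \<xi> m \<epsilon> = \<gamma>))"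
    proof (intro allI impI, elim conjE)
      fix U M assume U: "finite U" "\<forall>\<xi>\<in>U. \<delta> < \<xi>"
      have "\<forall>\<^sub>F m in sequentially. \<delta> \<in> part \<xi> m" if "\<xi> \<in> U" for \<xi>
        using part_cofinal [OF bspec [OF U(2) that]] unfolding eventually_sequentially .
      then have "\<forall>\<^sub>F m in sequentially. \<forall>\<xi>\<in>U. \<delta> \<in> part \<xi> m"
        using U(1) by (simp add: eventually_ball_finite)
      then obtain k1 where k1: "\<And>m \<xi>. k1 \<le> m \<Longrightarrow> \<xi> \<in> U \<Longrightarrow> \<delta> \<in> part \<xi> m"
        unfolding eventually_sequentially by blast
      define N where "N = max M k1"
      \<comment> \<open>The shift by two gives a strict inequality: \<open>csuc (\<mu>s N) \<le>
        \<mu>s (Suc N) < \<mu>s (Suc (Suc N)) \<le> cof \<gamma>\<close>.\<close>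
      obtain \<gamma> where \<gamma>: "\<gamma> \<in> Q \<inter> E \<inter> C \<delta>" "\<gamma> \<notin> acc (C \<delta>) \<delta>" "\<mu>s (Suc (Suc N)) \<le> cof \<gamma>" "c0 \<delta> z' \<le> \<gamma>"
        using positive_large [OF \<delta>S _ \<delta>(2) mus_below z'\<delta>] by blast
      have "\<gamma> < \<delta>" using C_club [OF \<delta>S] \<gamma>(1) unfolding club_in_def by auto
      obtain e k where ek: "e < \<sigma>" "\<gamma> \<in> Iv c0 \<delta> e k"
        using nacc_in_Iv [where ?c0.0 = c0 and \<delta> = \<delta>, OF c0_mono [OF \<delta>S] c0_club [OF \<delta>S] c0_C [OF \<delta>S] \<open>\<gamma> < \<delta>\<close> \<gamma>(2) z(1)]
          c0z \<gamma>(4) by (metis less_le_trans)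
      \<comment> \<open>The interval index k of \<gamma> is not controlled and may exceed N. Either
        way \<open>cof \<gamma>\<close> is above \<open>csuc (\<mu>s m)\<close>: by positivity if m
        = N, by the property of non-accumulation points if m = k.\<close>
      define m where "m = max N k"
      have "csuc (\<mu>s N) < cof \<gamma>"
        using csuc_mus_le [of N] \<gamma>(3) mus_mono
        by (meson le_less_trans less_le_trans lessI strict_mono_less)
      moreover have "csuc (\<mu>s k) < cof \<gamma>"
        using C_nacc [OF \<delta>S ek(1)] \<gamma>(1,2) ek(2) unfolding nacc_def by blast
      ultimately have cof: "csuc (\<mu>s m) < cof \<gamma>"
        unfolding m_def max_def by simp
      have "\<gamma> \<in> hull \<xi> m" if "\<xi> \<in> U" for \<xi>
      proof -
        have "\<delta> \<in> S \<inter> part \<xi> m" using k1 [OF _ that] \<delta>S unfolding m_def N_def by simp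
        moreover have "\<gamma> \<in> C \<delta> \<inter> Iv c0 \<delta> e k" "k \<in> {..m}" "e \<in> seg \<sigma>"
          using \<gamma>(1) ek by (auto simp: m_def)
        ultimately show ?thesis unfolding hull_def by blast
      qed
      then have "\<forall>\<xi>\<in>U. \<exists>y<\<gamma>. \<forall>\<epsilon>. y < \<epsilon> \<and> \<epsilon> < \<gamma> \<longrightarrow> nxt \<xi> m \<epsilon> = \<gamma>"
        using nxt_eq cof by blast
      then obtain y where y: "\<And>\<xi>. \<xi> \<in> U \<Longrightarrow> y \<xi> < \<gamma>"
        "\<And>\<xi> \<epsilon>. \<xi> \<in> U \<Longrightarrow> y \<xi> < \<epsilon> \<Longrightarrow> \<epsilon> < \<gamma> \<Longrightarrow> nxt \<xi> m \<epsilon> = \<gamma>"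
        by metis
      define Y where "Y = Max (insert (c0 \<delta> z) (y ` U))"
      have "Y \<in> insert (c0 \<delta> z) (y ` U)" unfolding Y_def using U(1) by (intro Max_in) auto
      then have "Y < \<gamma>" using y(1) c0z \<gamma>(4) by auto
      moreover have "y \<xi> \<le> Y" if "\<xi> \<in> U" for \<xi>
        unfolding Y_def using U(1) that by (intro Max_ge) auto
      ultimately have "\<exists>y<\<gamma>. \<forall>\<xi>\<in>U. \<forall>\<epsilon>. y < \<epsilon> \<and> \<epsilon> < \<gamma> \<longrightarrow> nxt \<xi> m \<epsilon> = \<gamma>"
        using y(2) by (meson le_less_trans)
      moreover have "M \<le> m" by (simp add: m_def N_def)
      ultimately show "\<exists>m\<ge>M. \<exists>\<gamma>\<in>E \<inter> Q. \<gamma> < \<delta> \<and>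
        (\<exists>y<\<gamma>. \<forall>\<xi>\<in>U. \<forall>\<epsilon>. y < \<epsilon> \<and> \<epsilon> < \<gamma> \<longrightarrow> nxt \<xi> m \<epsilon> = \<gamma>)"
        using \<gamma>(1) \<open>\<gamma> < \<delta>\<close> by blast
    qed
  qed
qed

end

section \<open>Homogeneous triples and the colouring\<close>

locale club_scale = club_system \<mu> \<mu>s \<sigma> S c0 C + scale \<mu> \<mu>s f
  for \<mu> :: "'a::wellorder" and \<mu>s \<sigma> S c0 C f
begin

text \<open>The order of choices matters: \<delta>, then D above \<delta>, then the bound M
  depending on D, then m and \<gamma> from \<open>capture\<close>, and finally B between \<gamma>
  and \<delta> and A between y and \<gamma>. That A exists uses that \<gamma> itself lies in
  E.\<close>

lemma homogeneous_triple:
  assumes F: "cofinal_family F" and Q: "Q \<notin> idp \<mu> S C"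
  shows "\<exists>A\<in>F. \<exists>B\<in>F. \<exists>D\<in>F. \<forall>\<epsilon>\<in>A. \<forall>\<zeta>\<in>B. \<forall>\<xi>\<in>D.
    \<epsilon> < \<zeta> \<and> \<zeta> < \<xi> \<and> nxt \<xi> (lev \<zeta> \<xi>) \<epsilon> \<in> Q"
proof -
  obtain E where E: "club E"
    and low: "\<forall>\<delta>\<in>E. \<forall>\<beta><\<delta>. \<exists>u\<in>F. \<forall>x\<in>u. \<beta> < x \<and> x < \<delta>"
    and mid: "\<forall>\<delta>\<in>E. \<forall>U. \<not> countable (seg (cof \<delta>)) \<and> finite U \<and> (\<forall>\<xi>\<in>U. \<delta> < \<xi>) \<longrightarrow>
      (\<exists>M. \<forall>m\<ge>M. \<forall>\<beta><\<delta>. \<exists>u\<in>F. \<forall>\<zeta>\<in>u. \<beta> < \<zeta> \<and> \<zeta> < \<delta> \<and> (\<forall>\<xi>\<in>U. lev \<zeta> \<xi> = m))"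
    by (rule lev_control [OF F])
  obtain \<delta> where \<delta>: "\<delta> \<in> S \<inter> E"
    and cap: "\<forall>U M. finite U \<and> (\<forall>\<xi>\<in>U. \<delta> < \<xi>) \<longrightarrow> (\<exists>m\<ge>M. \<exists>\<gamma>\<in>E \<inter> Q. \<gamma> < \<delta> \<and>
      (\<exists>y<\<gamma>. \<forall>\<xi>\<in>U. \<forall>\<epsilon>. y < \<epsilon> \<and> \<epsilon> < \<gamma> \<longrightarrow> nxt \<xi> m \<epsilon> = \<gamma>))"
    by (rule capture [OF Q E])
  obtain D where D: "D \<in> F" "finite D" "\<forall>\<xi>\<in>D. \<delta> < \<xi>"
    using F unfolding cofinal_family_def by blast
  have "\<exists>M. \<forall>m\<ge>M. \<forall>\<beta><\<delta>. \<exists>u\<in>F. \<forall>\<zeta>\<in>u. \<beta> < \<zeta> \<and> \<zeta> < \<delta> \<and> (\<forall>\<xi>\<in>D. lev \<zeta> \<xi> = m)"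
    by (rule mid [THEN bspec, THEN spec, THEN mp])
      (use S_cof sigma_uncountable \<delta> D(2,3) in auto)
  then obtain M where M: "\<And>m \<beta>. M \<le> m \<Longrightarrow> \<beta> < \<delta> \<Longrightarrow>
      \<exists>u\<in>F. \<forall>\<zeta>\<in>u. \<beta> < \<zeta> \<and> \<zeta> < \<delta> \<and> (\<forall>\<xi>\<in>D. lev \<zeta> \<xi> = m)"
    by blast
  have "\<exists>m\<ge>M. \<exists>\<gamma>\<in>E \<inter> Q. \<gamma> < \<delta> \<and>
      (\<exists>y<\<gamma>. \<forall>\<xi>\<in>D. \<forall>\<epsilon>. y < \<epsilon> \<and> \<epsilon> < \<gamma> \<longrightarrow> nxt \<xi> m \<epsilon> = \<gamma>)"
    by (rule cap [THEN spec, THEN spec, THEN mp]) (use D(2,3) in auto)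
  then obtain m \<gamma> y where m: "M \<le> m" "\<gamma> \<in> E \<inter> Q" "\<gamma> < \<delta>" "y < \<gamma>"
    and nxt: "\<And>\<xi> \<epsilon>. \<xi> \<in> D \<Longrightarrow> y < \<epsilon> \<Longrightarrow> \<epsilon> < \<gamma> \<Longrightarrow> nxt \<xi> m \<epsilon> = \<gamma>"
    by blast
  obtain B where B: "B \<in> F" "\<And>\<zeta>. \<zeta> \<in> B \<Longrightarrow> \<gamma> < \<zeta> \<and> \<zeta> < \<delta> \<and> (\<forall>\<xi>\<in>D. lev \<zeta> \<xi> = m)"
    using M [OF m(1,3)] by blast
  obtain A where A: "A \<in> F" "\<And>\<epsilon>. \<epsilon> \<in> A \<Longrightarrow> y < \<epsilon> \<and> \<epsilon> < \<gamma>"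
    using low m(2,4) by blast
  have "\<epsilon> < \<zeta> \<and> \<zeta> < \<xi> \<and> nxt \<xi> (lev \<zeta> \<xi>) \<epsilon> \<in> Q" if "\<epsilon> \<in> A" "\<zeta> \<in> B" "\<xi> \<in> D" for \<epsilon> \<zeta> \<xi>
  proof -
    have "nxt \<xi> (lev \<zeta> \<xi>) \<epsilon> = \<gamma>"
      using nxt [OF that(3)] A(2) [OF that(1)] B(2) [OF that(2)] that(3) by simp
    then show ?thesis
      using A(2) [OF that(1)] B(2) [OF that(2)] bspec [OF D(3) that(3)] m(2)
      by (metis IntD2 less_trans)
  qed
  then show ?thesis
    by (intro bexI [OF _ A(1)] bexI [OF _ B(1)] bexI [OF _ D(1)] ballI)
qed

lemma scale_separates:
  assumes "finite u"
  shows "\<exists>n. inj_on (\<lambda>\<epsilon>. f \<epsilon> n) u"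
proof -
  have "\<forall>\<^sub>F n in sequentially. \<epsilon> < \<epsilon>' \<longrightarrow> f \<epsilon> n < f \<epsilon>' n" for \<epsilon> \<epsilon>'
    by (cases "\<epsilon> < \<epsilon>'") (simp_all add: f_incr)
  then have "\<forall>\<^sub>F n in sequentially. \<forall>\<epsilon>\<in>u. \<forall>\<epsilon>'\<in>u. \<epsilon> < \<epsilon>' \<longrightarrow> f \<epsilon> n < f \<epsilon>' n"
    using assms by (simp add: eventually_ball_finite)
  then obtain n where "\<forall>\<epsilon>\<in>u. \<forall>\<epsilon>'\<in>u. \<epsilon> < \<epsilon>' \<longrightarrow> f \<epsilon> n < f \<epsilon>' n"
    unfolding eventually_sequentially by blast
  then have "inj_on (\<lambda>\<epsilon>. f \<epsilon> n) u"
    by (intro inj_onI) (metis less_irrefl neqE)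
  then show ?thesis by blast
qed

text \<open>Choosing from each set that meets the ordinals up to b one such point is injective by
  disjointness, so there are at most \<mu> such indices and they are bounded.\<close>

lemma disjoint_family_above:
  fixes t :: "'a \<Rightarrow> 'a set"
  assumes "\<And>\<alpha> \<beta>. \<alpha> \<noteq> \<beta> \<Longrightarrow> t \<alpha> \<inter> t \<beta> = {}"
  shows "\<exists>\<alpha>. \<forall>x\<in>insert \<alpha> (t \<alpha>). b < x"
proof -
  let ?bad = "{\<alpha>. \<exists>x\<in>t \<alpha>. x \<le> b}"
  have "\<exists>g. \<forall>\<alpha>\<in>?bad. g \<alpha> \<in> t \<alpha> \<and> g \<alpha> \<le> b"
    by (rule bchoice) blast
  then obtain g where g: "\<And>\<alpha>. \<alpha> \<in> ?bad \<Longrightarrow> g \<alpha> \<in> t \<alpha> \<and> g \<alpha> \<le> b" by blast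
  have "inj_on g ?bad"
  proof (rule inj_onI, rule ccontr)
    fix \<alpha> \<beta> assume "\<alpha> \<in> ?bad" "\<beta> \<in> ?bad" "g \<alpha> = g \<beta>" "\<alpha> \<noteq> \<beta>"
    then have "g \<alpha> \<in> t \<alpha> \<inter> t \<beta>" using g [of \<alpha>] g [of \<beta>] by simp
    then show False using assms [OF \<open>\<alpha> \<noteq> \<beta>\<close>] by simp
  qed
  moreover have "g ` ?bad \<subseteq> insert b (seg b)" using g by fastforce
  ultimately have "?bad \<lesssim> insert b (seg b)"
    unfolding lepoll_def by blast
  then obtain z where z: "\<forall>\<alpha>\<in>?bad. \<alpha> < z"
    using bounded lepoll_trans [OF _ insert_seg_lepoll] by blast
  obtain \<alpha> where \<alpha>: "z < \<alpha>" "b < \<alpha>" using countable_bounded [of "{z, b}"] by auto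
  then have "\<alpha> \<notin> ?bad" using z by (meson less_asym)
  then show ?thesis
    using \<alpha>(2) by (intro exI [of _ \<alpha>]) (auto simp: not_le)
qed

theorem triple_colouring:
  fixes P :: "'a \<Rightarrow> 'a set"
  assumes P: "\<And>i. i < \<mu> \<Longrightarrow> P i \<notin> idp \<mu> S C"
    and disj: "\<And>i j. i < \<mu> \<Longrightarrow> j < \<mu> \<Longrightarrow> i \<noteq> j \<Longrightarrow> P i \<inter> P j = {}"
  shows "\<exists>d :: 'a set \<Rightarrow> 'a. \<forall>(t :: 'a \<Rightarrow> 'a set) c.
           (\<forall>\<alpha>. finite (t \<alpha>)) \<and> (\<forall>\<alpha> \<beta>. \<alpha> \<noteq> \<beta> \<longrightarrow> t \<alpha> \<inter> t \<beta> = {}) \<longrightarrow>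
           (\<exists>\<alpha> \<beta> \<gamma>. \<alpha> < \<beta> \<and> \<beta> < \<gamma> \<and>
              (\<forall>\<epsilon>\<in>t \<alpha>. \<forall>\<zeta>\<in>t \<beta>. \<forall>\<xi>\<in>t \<gamma>. d {\<epsilon>, \<zeta>, \<xi>} = c))"
proof -
  \<comment> \<open>Tables consist of a scale coordinate and a finite list of pairs below \<mu>.
    There are at most \<mu> of them, so pieces of the partition can be indexed by tables.\<close>
  let ?K = "(UNIV :: nat set) \<times> lists (seg \<mu> \<times> seg \<mu>)"
  have "lists (seg \<mu> \<times> seg \<mu>) \<lesssim> seg \<mu> \<times> seg \<mu>"
    using infinite_seg_mu by (intro lists_lepoll_infinite) (auto simp: finite_cartesian_product_iff)
  then have "lists (seg \<mu> \<times> seg \<mu>) \<lesssim> seg \<mu>"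
    using Times_lepoll [OF infinite_seg_mu lepoll_refl lepoll_refl] by (rule lepoll_trans)
  then have K: "?K \<lesssim> seg \<mu>"
    by (rule Times_lepoll [OF infinite_seg_mu countable_lepoll_infinite [OF countableI_type infinite_seg_mu]])
  then obtain enc where enc: "inj_on enc ?K" "enc ` ?K \<subseteq> seg \<mu>"
    unfolding lepoll_def by blast
  define col where "col x = (THE i. i < \<mu> \<and> x \<in> P i)" for x
  have col: "col x = i" if "i < \<mu>" "x \<in> P i" for x i
    unfolding col_def using that disj by (intro the_equality) blast+
  \<comment> \<open>In a table (n, L) the entry filed under \<open>f \<epsilon> n\<close> is meant
    as a value of \<open>code \<epsilon>\<close>; inverting that injection recovers the
    colour.\<close>
  define dec where "dec i \<epsilon> = (case inv_into ?K enc i of (n, L) \<Rightarrow>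
      inv_into (seg \<epsilon>) (code \<epsilon>) (THE v. (f \<epsilon> n, v) \<in> set L))" for i \<epsilon>
  define d where "d s = (let \<epsilon> = Min s; \<zeta> = Min (s - {\<epsilon>}); \<xi> = Max s in
      dec (col (nxt \<xi> (lev \<zeta> \<xi>) \<epsilon>)) \<epsilon>)" for s :: "'a set"
  have d_eq: "d {\<epsilon>, \<zeta>, \<xi>} = dec (col (nxt \<xi> (lev \<zeta> \<xi>) \<epsilon>)) \<epsilon>" if "\<epsilon> < \<zeta>" "\<zeta> < \<xi>" for \<epsilon> \<zeta> \<xi>
  proof -
    have "{\<epsilon>, \<zeta>, \<xi>} - {\<epsilon>} = {\<zeta>, \<xi>}" "Min {\<epsilon>, \<zeta>, \<xi>} = \<epsilon>" "Min {\<zeta>, \<xi>} = \<zeta>" "Max {\<epsilon>, \<zeta>, \<xi>} = \<xi>"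
      using that by (auto simp: min_def max_def)
    then show ?thesis unfolding d_def Let_def by simp
  qed
  show ?thesis
  proof (intro exI [of _ d] allI impI, elim conjE)
    fix t :: "'a \<Rightarrow> 'a set" and c
    assume fin: "\<forall>\<alpha>. finite (t \<alpha>)" and t: "\<forall>\<alpha> \<beta>. \<alpha> \<noteq> \<beta> \<longrightarrow> t \<alpha> \<inter> t \<beta> = {}"
    \<comment> \<open>A pair \<open>(n, L)\<close> coded by an ordinal below \<mu> prescribes, through the n-th scale
      coordinate, an ordinal below each point of u; this upgrades \<mu> colours to all of 'a.\<close>
    define codes where "codes u k \<longleftrightarrow> k \<in> ?K \<and> inj_on (\<lambda>\<epsilon>. f \<epsilon> (fst k)) u \<and>
        set (snd k) = (\<lambda>\<epsilon>. (f \<epsilon> (fst k), code \<epsilon> c)) ` u" for u k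
    have codes_ex: "\<exists>k. codes u k" if u: "finite u" "\<forall>\<epsilon>\<in>u. c < \<epsilon>" for u
    proof -
      obtain n where n: "inj_on (\<lambda>\<epsilon>. f \<epsilon> n) u" using scale_separates [OF u(1)] by blast
      obtain L where L: "set L = (\<lambda>\<epsilon>. (f \<epsilon> n, code \<epsilon> c)) ` u"
        using finite_list u(1) by (meson finite_imageI)
      have "code \<epsilon> c < \<mu>" if "c < \<epsilon>" for \<epsilon> using code(2) [of \<epsilon>] that by fastforce
      then have "set L \<subseteq> seg \<mu> \<times> seg \<mu>"
        using L u(2) less_trans [OF f_less mus_below] by auto
      then have "(n, L) \<in> ?K" by auto
      then have "codes u (n, L)"
        unfolding codes_def using n L by (simp only: fst_conv snd_conv)
      then show ?thesis by blast
    qed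
    have dec_codes: "dec (enc k) \<epsilon> = c" if "codes u k" "\<epsilon> \<in> u" "c < \<epsilon>" for u k \<epsilon>
    proof -
      obtain n L where k: "k = (n, L)" by (cases k)
      then have L: "inj_on (\<lambda>\<epsilon>. f \<epsilon> n) u" "set L = (\<lambda>\<epsilon>. (f \<epsilon> n, code \<epsilon> c)) ` u"
        using that(1) unfolding codes_def by auto
      have "(THE v. (f \<epsilon> n, v) \<in> set L) = code \<epsilon> c"
        using L that(2) by (intro the_equality) (auto dest: inj_onD)
      moreover have "inv_into ?K enc (enc k) = k"
        using enc(1) that(1) unfolding codes_def by (simp add: inv_into_f_f)
      ultimately show ?thesis
        using code(1) [of \<epsilon>] that(3) by (simp add: dec_def k inv_into_f_f)
    qed
    \<comment> \<open>Inserting the index \<alpha> into \<open>t \<alpha>\<close> makes separated sets have increasing indices.\<close>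
    have "\<exists>\<alpha> k. (\<forall>x\<in>insert \<alpha> (t \<alpha>). b < x \<and> c < x) \<and> codes (insert \<alpha> (t \<alpha>)) k" for b
    proof -
      obtain \<alpha> where "\<forall>x\<in>insert \<alpha> (t \<alpha>). max b c < x"
        using disjoint_family_above [of t "max b c"] t by blast
      then show ?thesis
        using codes_ex [of "insert \<alpha> (t \<alpha>)"] fin by auto
    qed
    then have "\<forall>b. \<exists>\<alpha> k. (\<forall>x\<in>insert \<alpha> (t \<alpha>). b < x \<and> c < x) \<and> codes (insert \<alpha> (t \<alpha>)) k"
      by blast
    then have "\<exists>a \<kappa>. \<forall>b. (\<forall>x\<in>insert (a b) (t (a b)). b < x \<and> c < x) \<and>
        codes (insert (a b) (t (a b))) (\<kappa> b)"
      unfolding choice_iff .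
    then obtain a \<kappa> where a: "\<And>b x. x \<in> insert (a b) (t (a b)) \<Longrightarrow> b < x \<and> c < x"
      and \<kappa>: "\<And>b. codes (insert (a b) (t (a b))) (\<kappa> b)"
      by blast
    have "range \<kappa> \<subseteq> ?K" using \<kappa> unfolding codes_def by blast
    \<comment> \<open>At most \<mu> tables occur, so one table k serves sets lying arbitrarily high;
      these sets form the family \<open>?F\<close>.\<close>
    then obtain k where k: "\<And>b. \<exists>\<beta>\<ge>b. \<kappa> \<beta> = k"
      using pigeonhole [OF lepoll_trans [OF subset_imp_lepoll K]] by blast
    have "k \<in> ?K" using k \<kappa> unfolding codes_def by blast
    then have "enc k \<in> seg \<mu>" using enc(2) by blast
    then have i: "enc k < \<mu>" by simp
    let ?F = "{insert (a b) (t (a b)) | b. \<kappa> b = k}"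
    have "cofinal_family ?F"
      unfolding cofinal_family_def
    proof (intro conjI ballI allI)
      fix u assume "u \<in> ?F"
      then obtain b where "u = insert (a b) (t (a b))" by blast
      then show "finite u" by (simp add: fin)
    next
      fix \<beta>
      obtain b where b: "\<beta> \<le> b" "\<kappa> b = k" using k by blast
      have "\<forall>x\<in>insert (a b) (t (a b)). \<beta> < x"
        using a [of _ b] b(1) by (meson le_less_trans)
      moreover have "insert (a b) (t (a b)) \<in> ?F" using b(2) by blast
      ultimately show "\<exists>u\<in>?F. \<forall>x\<in>u. \<beta> < x" by (rule bexI)
    qed
    from homogeneous_triple [OF this P [OF i]]
    obtain A B D where ABD: "A \<in> ?F" "B \<in> ?F" "D \<in> ?F"
      and homog: "\<forall>\<epsilon>\<in>A. \<forall>\<zeta>\<in>B. \<forall>\<xi>\<in>D. \<epsilon> < \<zeta> \<and> \<zeta> < \<xi> \<and> nxt \<xi> (lev \<zeta> \<xi>) \<epsilon> \<in> P (enc k)"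
      by (elim bexE)
    \<comment> \<open>The colour is decoded at \<epsilon>, so the table is read on A, the set with
      index p.\<close>
    obtain p q r where pqr: "\<kappa> p = k" "A = insert (a p) (t (a p))"
        "B = insert (a q) (t (a q))" "D = insert (a r) (t (a r))"
      using ABD by blast
    have col3: "\<epsilon> < \<zeta> \<and> \<zeta> < \<xi> \<and> nxt \<xi> (lev \<zeta> \<xi>) \<epsilon> \<in> P (enc k)"
      if "\<epsilon> \<in> insert (a p) (t (a p))" "\<zeta> \<in> insert (a q) (t (a q))"
        "\<xi> \<in> insert (a r) (t (a r))" for \<epsilon> \<zeta> \<xi>
      using homog [unfolded pqr(2-4)] that by blast
    have "d {\<epsilon>, \<zeta>, \<xi>} = c" if "\<epsilon> \<in> t (a p)" "\<zeta> \<in> t (a q)" "\<xi> \<in> t (a r)" for \<epsilon> \<zeta> \<xi>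
      using col3 [of \<epsilon> \<zeta> \<xi>] that d_eq col [OF i] dec_codes [OF \<kappa> [of p], of \<epsilon>] a [of \<epsilon> p] pqr(1) by simp
    moreover have "a p < a q" "a q < a r" using col3 [of "a p" "a q" "a r"] by auto
    ultimately show "\<exists>\<alpha> \<beta> \<gamma>. \<alpha> < \<beta> \<and> \<beta> < \<gamma> \<and>
        (\<forall>\<epsilon>\<in>t \<alpha>. \<forall>\<zeta>\<in>t \<beta>. \<forall>\<xi>\<in>t \<gamma>. d {\<epsilon>, \<zeta>, \<xi>} = c)"
      by (intro exI conjI ballI)
  qed
qed

end

section \<open>From the hypotheses of the setting to the colouring\<close>

theorem theorem8p4:
  fixes \<mu> \<sigma> :: "'a::wellorder"
    and \<mu>s :: "nat \<Rightarrow> 'a"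
    and S :: "'a set"
    and c0 :: "'a \<Rightarrow> 'a \<Rightarrow> 'a"
    and C :: "'a \<Rightarrow> 'a set"
  assumes mu_card: "is_cardinal \<mu>"
    and lambda_bound: "\<forall>x::'a. seg x \<lesssim> seg \<mu>"
    and lambda_big: "\<not> ((UNIV :: 'a set) \<lesssim> seg \<mu>)"
    and mus_mono: "strict_mono \<mu>s"
    and mus_regular: "\<forall>n. regular (\<mu>s n)"
    and mus_below: "\<forall>n. \<mu>s n < \<mu>"
    and mus_cofinal: "\<forall>y<\<mu>. \<exists>n. y < \<mu>s n"
    and sigma_regular: "regular \<sigma>"
    and sigma_uncountable: "\<not> countable (seg \<sigma>)"
    and sigma_below: "\<sigma> < \<mu>s 0"
    and S_cof: "S \<subseteq> {\<delta>. cof \<delta> = \<sigma>}"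
    and S_stat: "stationary S"
    and c0_club: "\<forall>\<delta>\<in>S. strict_mono_on (seg \<sigma>) (c0 \<delta>) \<and> club_in (c0 \<delta> ` seg \<sigma>) \<delta>"
    and c0_guess: "\<forall>E. club E \<longrightarrow> stationary {\<delta>\<in>S. c0 \<delta> ` seg \<sigma> \<subseteq> E}"
    and C_club: "\<forall>\<delta>\<in>S. club_in (C \<delta>) \<delta> \<and> c0 \<delta> ` seg \<sigma> \<subseteq> C \<delta>"
    and C_size: "\<forall>\<delta>\<in>S. \<forall>e<\<sigma>. \<forall>m. C \<delta> \<inter> Iv c0 \<delta> e m \<lesssim> seg (csuc (\<mu>s m))"
    and C_nacc: "\<forall>\<delta>\<in>S. \<forall>e<\<sigma>. \<forall>m. \<forall>\<alpha>\<in>nacc (C \<delta>) \<delta> \<inter> Iv c0 \<delta> e m. csuc (\<mu>s m) < cof \<alpha>"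
    and C_guess: "\<forall>E. club E \<longrightarrow>
        stationary {\<delta>\<in>S. \<forall>e<\<sigma>. \<forall>m. E \<inter> nacc (C \<delta>) \<delta> \<inter> Iv c0 \<delta> e m \<noteq> {}}"
    and scale: "carries_scale \<mu>s"
    and not_sat: "\<not> weakly_saturated (idp \<mu> S C) \<mu>"
  shows "\<exists>d :: 'a set \<Rightarrow> 'a. \<forall>(t :: 'a \<Rightarrow> 'a set) c.
           (\<forall>\<alpha>. finite (t \<alpha>)) \<and> (\<forall>\<alpha> \<beta>. \<alpha> \<noteq> \<beta> \<longrightarrow> t \<alpha> \<inter> t \<beta> = {}) \<longrightarrow>
           (\<exists>\<alpha> \<beta> \<gamma>. \<alpha> < \<beta> \<and> \<beta> < \<gamma> \<and>
              (\<forall>\<epsilon>\<in>t \<alpha>. \<forall>\<zeta>\<in>t \<beta>. \<forall>\<xi>\<in>t \<gamma>. d {\<epsilon>, \<zeta>, \<xi>} = c))"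
proof -
  obtain f :: "'a \<Rightarrow> nat \<Rightarrow> 'a" where f: "\<forall>\<alpha> n. f \<alpha> n < \<mu>s n"
    "\<forall>\<alpha> \<beta>. \<alpha> < \<beta> \<longrightarrow> (\<forall>\<^sub>F n in sequentially. f \<alpha> n < f \<beta> n)"
    "\<forall>g. (\<forall>n. g n < \<mu>s n) \<longrightarrow> (\<exists>\<alpha>. \<forall>\<^sub>F n in sequentially. g n \<le> f \<alpha> n)"
    using scale unfolding carries_scale_def by blast
  interpret club_scale \<mu> \<mu>s \<sigma> S c0 C f
  proof
    show "\<exists>\<alpha>. \<forall>\<^sub>F n in sequentially. g n \<le> f \<alpha> n" if "\<And>n. g n < \<mu>s n" for g
      using f(3) that by blast
    show "\<exists>n. y < \<mu>s n" if "y < \<mu>" for y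
      using mus_cofinal that by blast
    show "cof \<delta> = \<sigma>" if "\<delta> \<in> S" for \<delta>
      using S_cof that by blast
    show "csuc (\<mu>s m) < cof \<alpha>"
      if "\<delta> \<in> S" "e < \<sigma>" "\<alpha> \<in> nacc (C \<delta>) \<delta> \<inter> Iv c0 \<delta> e m" for \<delta> e \<alpha> m
      using C_nacc that by blast
  qed (simp_all add: lambda_bound lambda_big mus_mono mus_regular mus_below sigma_uncountable
      sigma_below c0_club C_club C_size f)
  obtain P :: "'a \<Rightarrow> 'a set" where "\<forall>i<\<mu>. P i \<notin> idp \<mu> S C"
    "\<forall>i<\<mu>. \<forall>j<\<mu>. i \<noteq> j \<longrightarrow> P i \<inter> P j = {}"
    using not_sat unfolding weakly_saturated_def by blast
  then show ?thesis
    by (intro triple_colouring [of P]) simp_all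
qed

end
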